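(* Let $p\in(0,1)$ be a constant and let $\mathbf G_n\sim G(n,p)$. Let $\tau$ be a closed term of the language $\mathrm{Agg}_{\mathcal F_{\mathrm{rellip}}}$, and write $\tau_n=[\![\tau]\!]_{\mathbf G_n}$. Then either (i) $\tau_n=0$ with high probability, and $\tau_n\stackrel{L_q}{\to}0$ as $n\to\infty$ for every $q>0$; or (ii) $\mathbb E\tau_n>0$ for all sufficiently large $n$, $\tau_n>0$ with high probability, and $\tau_n/\mathbb E\tau_n\stackrel{L_q}{\to}1$ as $n\to\infty$ for every $q>0$.
   Context: $G(n,p)$ is the random graph on vertex set $[n]=\{1,\dots,n\}$ in which each pair of distinct vertices is an edge independently with probability $p$. "With high probability" means with probability tending to $1$ as $n\to\infty$. $X_n\stackrel{L_q}{\to}X$ means $\mathbb E|X_n-X|^q\to0$. Graphs are finite, undirected, without loops. Relative Lipschitz functions. A function $f:\mathbb R_{>0}^m\to\mathbb R_{>0}$ is relative Lipschitz if there is $C>0$ with $\frac{|f(x)-f(y)|}{f(x)+f(y)}\le C\frac{\|x-y\|}{\|x+y\|}$ for all $x,y\in\mathbb R_{>0}^m$ (Euclidean norm). For $f:\mathbb R_{\ge0}^m\to\mathbb R_{\ge0}$ and $\varnothing\ne I=\{j_1,\dots,j_{m'}\}\subseteq[m]$, the $I$-specialisation $f_I:\mathbb R_{>0}^{m'}\to\mathbb R_{\ge0}$ is $f_I(y)=f(x)$, where $x_{j_i}=y_i$ for $i\in[m']$ and $x_j=0$ for $j\notin I$. A function $f:\mathbb R_{\ge0}^m\to\mathbb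 R_{\ge0}$ is relative Lipschitz if every specialisation is either positive-valued and relative Lipschitz, or identically zero. $\mathcal F_{\mathrm{rellip}}$ is the set of all relative Lipschitz functions $f:\mathbb R_{\ge0}^m\to\mathbb R_{\ge0}$, $m\ge1$. The language $\mathrm{Agg}_{\mathcal F}$. For a class $\mathcal F$ of functions, terms with node variables are built inductively and interpreted in a graph $G$ with an assignment of vertices of $G$ to the free variables as follows. - Atomic terms: constants $c\in\mathbb R_{\ge0}$ (value $c$); $\mathrm E(u,v)$ (value $1$ if $\{u,v\}\in E(G)$, else $0$); $u=v$ (value $1$ if equal, else $0$). - $f(\tau_1,\dots,\tau_m)$ for $f\in\mathcal F$ of arity $m$: apply $f$ to the values. - $\mathrm{Avg}_v\,\tau(\bar u,v)$: value $\frac1{|V(G)|}\sum_{v\in V(G)}\tau(\bar u,v)$. - $\mathrm{LAvg}_{w\mathrm Ev}\,\tau(w,\bar u,v)$ (free variables $w,\bar u$): the average of $\tau(w,\bar u,v)$ over the neighbours $v$ of $w$, and $0$ if $w$ has no neighbours. - $\mathrm{Max}_v\,\tau(\bar u,v)$, $\mathrm{Min}_v\,\tau(\bar u,v)$, $\Sigma_v\,\tau(\bar u,v)$: the maximum, minimum and sum over all $v\in V(G)$. A term is closed if it has no free variables; $[\![\tau]\!]_G$ denotes the value of a closed term $\tau$ in $G$. *)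

theory Defs
  imports "HOL-Probability.Probability" "HOL-Probability.Product_PMF"
begin

text \<open>
  A function of arity $m$ on nonnegative reals is represented by \<^typ>\<open>real list \<Rightarrow> real\<close>; only its
  values on the lists of length $m$ with nonnegative entries matter.
\<close>

definition pos_vecs :: "nat \<Rightarrow> real list set" where
  "pos_vecs m = {x. length x = m \<and> (\<forall>a\<in>set x. a > 0)}"

definition nonneg_vecs :: "nat \<Rightarrow> real list set" where
  "nonneg_vecs m = {x. length x = m \<and> (\<forall>a\<in>set x. a \<ge> 0)}"

definition pos_rel_lipschitz :: "nat \<Rightarrow> (real list \<Rightarrow> real) \<Rightarrow> bool" where
  "pos_rel_lipschitz m f \<longleftrightarrow>
     (\<forall>x\<in>pos_vecs m. f x > 0) \<and>
     (\<exists>C>0. \<forall>x\<in>pos_vecs m. \<forall>y\<in>pos_vecs m.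
        \<bar>f x - f y\<bar> / (f x + f y)
          \<le> C * (L2_set (\<lambda>i. x ! i - y ! i) {..<m} / L2_set (\<lambda>i. x ! i + y ! i) {..<m}))"

text \<open>
  Coordinates are numbered from $0$, and $I$ is enumerated increasingly: for $j \in I$ the number
  of elements of $I$ below $j$ is the position of $j$ in $I$.
\<close>

definition specialisation ::
    "nat \<Rightarrow> (real list \<Rightarrow> real) \<Rightarrow> nat set \<Rightarrow> real list \<Rightarrow> real" where
  "specialisation m f I y =
     f (map (\<lambda>j. if j \<in> I then y ! card {i\<in>I. i < j} else 0) [0..<m])"

definition rel_lipschitz :: "nat \<Rightarrow> (real list \<Rightarrow> real) \<Rightarrow> bool" where
  "rel_lipschitz m f \<longleftrightarrow>
     (\<forall>x\<in>nonneg_vecs m. f x \<ge> 0) \<and>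
     (\<forall>I. I \<noteq> {} \<and> I \<subseteq> {..<m} \<longrightarrow>
        pos_rel_lipschitz (card I) (specialisation m f I) \<or>
        (\<forall>y\<in>pos_vecs (card I). specialisation m f I y = 0))"

text \<open>A class of functions is a set of pairs of an arity and a function of that arity.\<close>

type_synonym fun_class = "(nat \<times> (real list \<Rightarrow> real)) set"

definition F_rellip :: fun_class where
  "F_rellip = {(m, f). m \<ge> 1 \<and> rel_lipschitz m f}"

type_synonym 'a graph = "'a set \<times> 'a set set"

type_synonym var = nat

datatype agg =
    Const real
  | Edge var var
  | Equal var var
  | App "real list \<Rightarrow> real" "agg list"
  | Avg var agg
  | LAvg var var agg  \<comment> \<open>\<open>LAvg w v t\<close> averages over the neighbours \<open>v\<close> of \<open>w\<close>; it binds \<open>v\<close>, not \<open>w\<close>\<close>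
  | MaxV var agg
  | MinV var agg
  | SumV var agg

fun agg_term :: "fun_class \<Rightarrow> agg \<Rightarrow> bool" where
  "agg_term F (Const c) \<longleftrightarrow> c \<ge> 0"
| "agg_term F (Edge u v) \<longleftrightarrow> True"
| "agg_term F (Equal u v) \<longleftrightarrow> True"
| "agg_term F (App f ts) \<longleftrightarrow> (length ts, f) \<in> F \<and> (\<forall>t\<in>set ts. agg_term F t)"
| "agg_term F (Avg v t) \<longleftrightarrow> agg_term F t"
| "agg_term F (LAvg w v t) \<longleftrightarrow> w \<noteq> v \<and> agg_term F t"
| "agg_term F (MaxV v t) \<longleftrightarrow> agg_term F t"
| "agg_term F (MinV v t) \<longleftrightarrow> agg_term F t"
| "agg_term F (SumV v t) \<longleftrightarrow> agg_term F t"

fun free_vars :: "agg \<Rightarrow> var set" where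
  "free_vars (Const c) = {}"
| "free_vars (Edge u v) = {u, v}"
| "free_vars (Equal u v) = {u, v}"
| "free_vars (App f ts) = (\<Union>t\<in>set ts. free_vars t)"
| "free_vars (Avg v t) = free_vars t - {v}"
| "free_vars (LAvg w v t) = insert w (free_vars t - {v})"
| "free_vars (MaxV v t) = free_vars t - {v}"
| "free_vars (MinV v t) = free_vars t - {v}"
| "free_vars (SumV v t) = free_vars t - {v}"

definition closed_term :: "agg \<Rightarrow> bool" where
  "closed_term t \<longleftrightarrow> free_vars t = {}"

definition neighbours :: "'a graph \<Rightarrow> 'a \<Rightarrow> 'a set" where
  "neighbours G x = {y \<in> fst G. {x, y} \<in> snd G}"

fun interp :: "'a graph \<Rightarrow> (var \<Rightarrow> 'a) \<Rightarrow> agg \<Rightarrow> real" where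
  "interp G \<sigma> (Const c) = c"
| "interp G \<sigma> (Edge u v) = (if {\<sigma> u, \<sigma> v} \<in> snd G then 1 else 0)"
| "interp G \<sigma> (Equal u v) = (if \<sigma> u = \<sigma> v then 1 else 0)"
| "interp G \<sigma> (App f ts) = f (map (\<lambda>t. interp G \<sigma> t) ts)"
| "interp G \<sigma> (Avg v t) = (\<Sum>x\<in>fst G. interp G (\<sigma>(v := x)) t) / real (card (fst G))"
| "interp G \<sigma> (LAvg w v t) =
     (if neighbours G (\<sigma> w) = {} then 0
      else (\<Sum>x\<in>neighbours G (\<sigma> w). interp G (\<sigma>(v := x)) t)
             / real (card (neighbours G (\<sigma> w))))"
| "interp G \<sigma> (MaxV v t) = Max ((\<lambda>x. interp G (\<sigma>(v := x)) t) ` fst G)"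
| "interp G \<sigma> (MinV v t) = Min ((\<lambda>x. interp G (\<sigma>(v := x)) t) ` fst G)"
| "interp G \<sigma> (SumV v t) = (\<Sum>x\<in>fst G. interp G (\<sigma>(v := x)) t)"

lemma interp_cong:
  assumes "\<And>u. u \<in> free_vars t \<Longrightarrow> \<sigma> u = \<sigma>' u"
  shows "interp G \<sigma> t = interp G \<sigma>' t"
  using assms
proof (induction t arbitrary: \<sigma> \<sigma>')
  case (App f ts)
  have "map (interp G \<sigma>) ts = map (interp G \<sigma>') ts"
    using App.prems by (intro map_cong refl App.IH) auto
  then show ?case by (simp cong: map_cong)
next
  case (Avg v t)
  have "interp G (\<sigma>(v := x)) t = interp G (\<sigma>'(v := x)) t" for x
    using Avg.prems by (intro Avg.IH) auto
  then show ?case by simp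
next
  case (LAvg w v t)
  have "interp G (\<sigma>(v := x)) t = interp G (\<sigma>'(v := x)) t" for x
    using LAvg.prems by (intro LAvg.IH) auto
  moreover have "\<sigma> w = \<sigma>' w" using LAvg.prems by simp
  ultimately show ?case by simp
next
  case (MaxV v t)
  have "interp G (\<sigma>(v := x)) t = interp G (\<sigma>'(v := x)) t" for x
    using MaxV.prems by (intro MaxV.IH) auto
  then show ?case by simp
next
  case (MinV v t)
  have "interp G (\<sigma>(v := x)) t = interp G (\<sigma>'(v := x)) t" for x
    using MinV.prems by (intro MinV.IH) auto
  then show ?case by simp
next
  case (SumV v t)
  have "interp G (\<sigma>(v := x)) t = interp G (\<sigma>'(v := x)) t" for x
    using SumV.prems by (intro SumV.IH) auto
  then show ?case by simp
qed auto

text \<open>The assignment used here is irrelevant for closed terms, see below.\<close>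

definition closed_interp :: "agg \<Rightarrow> 'a graph \<Rightarrow> real" where
  "closed_interp t G = interp G (\<lambda>_. undefined) t"

lemma closed_interp_eq: "closed_term t \<Longrightarrow> interp G \<sigma> t = closed_interp t G"
  unfolding closed_interp_def closed_term_def by (rule interp_cong) auto

definition vertex_pairs :: "nat \<Rightarrow> nat set set" where
  "vertex_pairs n = {e. e \<subseteq> {1..n} \<and> card e = 2}"

definition random_graph :: "nat \<Rightarrow> real \<Rightarrow> nat graph pmf" where
  "random_graph n p =
     map_pmf (\<lambda>b. ({1..n}, {e \<in> vertex_pairs n. b e}))
       (Pi_pmf (vertex_pairs n) False (\<lambda>_. bernoulli_pmf p))"

lemma finite_vertex_pairs: "finite (vertex_pairs n)"
  unfolding vertex_pairs_def by (rule finite_subset[of _ "Pow {1..n}"]) auto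

text \<open>In particular every real random variable on the random graph is integrable.\<close>

lemma finite_set_random_graph: "finite (set_pmf (random_graph n p))"
proof (rule finite_subset)
  show "set_pmf (random_graph n p) \<subseteq> Pair {1..n} ` Pow (vertex_pairs n)"
    by (auto simp: random_graph_def)
qed (simp add: finite_vertex_pairs)

definition whp :: "(nat \<Rightarrow> 'a pmf) \<Rightarrow> ('a \<Rightarrow> bool) \<Rightarrow> bool" where
  "whp M P \<longleftrightarrow> (\<lambda>n. measure_pmf.prob (M n) {\<omega>. P \<omega>}) \<longlonglongrightarrow> 1"

text \<open>Convergence in $L_q$ of random variables to a constant. The integral is the intended one only
  if the integrands are integrable, as they are for distributions with finite support.\<close>

definition tendsto_Lq :: "real \<Rightarrow> (nat \<Rightarrow> 'a pmf) \<Rightarrow> (nat \<Rightarrow> 'a \<Rightarrow> real) \<Rightarrow> real \<Rightarrow> bool" where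
  "tendsto_Lq q M X c \<longleftrightarrow>
     (\<lambda>n. measure_pmf.expectation (M n) (\<lambda>\<omega>. \<bar>X n \<omega> - c\<bar> powr q)) \<longlonglongrightarrow> 0"

end

theory Submission
  imports Defs
begin

text \<open>
  A relative Lipschitz function is Lipschitz on the logarithmic scale, uniformly on each face of
  the orthant: if corresponding arguments agree up to a factor \<open>s\<close>, then the values agree up to
  \<open>s ^ a\<close> for a fixed \<open>a\<close>. Hence, if any two tuples of the same atomic type in graphs \<open>G\<close> and \<open>H\<close> have,
  for every one-point extension type, numbers of extensions agreeing up to a factor \<open>s\<close>, then the
  values of a term in \<open>G\<close> and \<open>H\<close> agree up to a fixed power of \<open>s\<close>. In the random graph all these
  numbers are concentrated up to an exponentially small failure probability (Hoeffding). Applied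
  to graphs of the same size with \<open>s\<close> close to 1 this gives concentration of the value; applied to
  graphs of different sizes, with some finite \<open>s\<close>, it shows that vanishing of the value does not
  depend on the size, which is the dichotomy. Nonzero values lie between \<open>(n + 2) ^ (- b)\<close> and
  \<open>(n + 2) ^ b\<close> in every graph on \<open>n\<close> vertices, so the failure event is negligible in every \<open>L\<^sub>q\<close>.
\<close>

section \<open>Relative Lipschitz functions on the logarithmic scale\<close>

text \<open>The faces of the orthant are independent of each other: a function in
  \<open>F_rellip\<close> may jump at the boundary or vanish on one face only, so additive closeness
  of arguments says nothing about the values. \<open>ratio_le\<close> is written without division so
  that, among nonnegative numbers, 0 is comparable only with 0. Comparable tuples then lie on one
  face, and vanishing is tracked by the same relation as size. No limit of a term is computed; two
  graphs are compared with each other. The exponent never depends on the factor \<open>s\<close>, so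
  one estimate serves factors near 1 (concentration) and factors as large as powers of
  \<open>n + 2\<close> (polynomial bounds). The obstacle is that the left side of the relative
  Lipschitz inequality is always below 1, so it carries no information about distant arguments; a
  large factor has to be split into many small ones without enlarging the exponent. Positive lower
  bounds on nonzero values are needed because the last step divides by the mean.\<close>

definition ratio_le :: "real \<Rightarrow> real \<Rightarrow> real \<Rightarrow> bool" where
  "ratio_le r a b \<longleftrightarrow> a \<le> r * b \<and> b \<le> r * a"

lemma ratio_leI: "a \<le> r * b \<Longrightarrow> b \<le> r * a \<Longrightarrow> ratio_le r a b"
  by (simp add: ratio_le_def)

lemma ratio_le_sym: "ratio_le r a b \<Longrightarrow> ratio_le r b a"
  by (simp add: ratio_le_def)

lemma ratio_le_refl: "1 \<le> r \<Longrightarrow> 0 \<le> a \<Longrightarrow> ratio_le r a a"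
  using mult_right_mono[of 1 r a] by (simp add: ratio_le_def)

lemma ratio_le_mono: "ratio_le r a b \<Longrightarrow> r \<le> s \<Longrightarrow> 0 \<le> a \<Longrightarrow> 0 \<le> b \<Longrightarrow> ratio_le s a b"
  unfolding ratio_le_def by (meson mult_right_mono order_trans)

lemma ratio_le_trans:
  assumes "ratio_le r a b" "ratio_le s b c" "0 \<le> r" "0 \<le> s"
  shows "ratio_le (r * s) a c"
proof (rule ratio_leI)
  have "a \<le> r * b" "b \<le> s * c" using assms by (auto simp: ratio_le_def)
  then show "a \<le> r * s * c" using mult_left_mono[of b "s * c" r] assms by (simp add: mult.assoc)
  have "c \<le> s * b" "b \<le> r * a" using assms by (auto simp: ratio_le_def)
  then show "c \<le> r * s * a" using mult_left_mono[of b "r * a" s] assms by (simp add: mult_ac)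
qed

lemma ratio_le_zero_iff: "ratio_le r a b \<Longrightarrow> 0 \<le> a \<Longrightarrow> 0 \<le> b \<Longrightarrow> a = 0 \<longleftrightarrow> b = 0"
  by (auto simp: ratio_le_def)

lemma ratio_le_power_mono:
  assumes "ratio_le (s ^ a) x y" "a \<le> b" "1 \<le> s" "0 \<le> x" "0 \<le> y"
  shows "ratio_le (s ^ b) x y"
  using assms(1) power_increasing[OF assms(2,3)] assms(4,5) by (rule ratio_le_mono)

lemma ratio_le_divide:
  assumes "ratio_le r a b" "ratio_le s c d" "0 \<le> a" "0 \<le> b" "0 \<le> c" "0 \<le> d" "0 \<le> r" "0 \<le> s"
  shows "ratio_le (r * s) (a / c) (b / d)"
proof (cases "c = 0")
  case True
  \<comment> \<open>Both denominators vanish together, and division by zero gives 0 on both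
    sides.\<close>
  then show ?thesis using ratio_le_zero_iff[OF assms(2)] assms by (simp add: ratio_le_def)
next
  case False
  have *: "a / c \<le> r * s * (b / d)"
    if "a \<le> r * b" "d \<le> s * c" "0 < c" "0 < d" "0 \<le> a" "0 \<le> b" for a b c d
  proof -
    have "a * d \<le> (r * b) * (s * c)" using that by (intro mult_mono) auto
    then show ?thesis using that by (simp add: field_simps)
  qed
  have "0 < c" "0 < d" using False ratio_le_zero_iff[OF assms(2)] assms by auto
  with assms show ?thesis
    using *[of a b d c] *[of b a c d] by (simp add: ratio_le_def)
qed

text \<open>On the logarithmic scale a path of length \<open>log s + log t\<close> is cut at
  distance \<open>log t\<close> from \<open>y\<close>: the witness is the projection of
  \<open>x\<close> onto the interval from \<open>y / t\<close> to \<open>y * t\<close>.\<close>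

lemma ratio_le_intermediate:
  fixes s :: real
  assumes "0 < x" "0 < y" "1 \<le> s" "1 \<le> t" "ratio_le (s * t) x y"
  shows "\<exists>z>0. ratio_le s x z \<and> ratio_le t z y"
proof -
  define z where "z = max (y / t) (min x (y * t))"
  have st: "x \<le> s * (t * y)" "y \<le> s * (t * x)" using assms by (auto simp: ratio_le_def mult_ac)
  have x: "x \<le> s * x" using assms by simp
  have yt: "y / t \<le> y" "y \<le> y * t" using assms by (auto simp: field_simps)
  have "0 < z" using assms by (simp add: z_def less_max_iff_disj)
  moreover have "ratio_le t z y"
  proof (rule ratio_leI)
    show "z \<le> t * y" using yt unfolding z_def by (simp add: mult.commute)
    have "y / t \<le> z" by (simp add: z_def)
    then show "y \<le> t * z" using assms by (simp add: field_simps)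
  qed
  moreover have "ratio_le s x z"
  proof (cases "x \<le> y * t")
    case True
    show ?thesis
    proof (rule ratio_leI)
      have "x \<le> z" using True by (simp add: z_def)
      then show "x \<le> s * z" using assms mult_left_mono[of x z s] x by linarith
      have "y / t \<le> s * x" using st assms by (simp add: field_simps)
      then show "z \<le> s * x" using True x by (simp add: z_def)
    qed
  next
    case False
    then have "z = y * t" using yt by (simp add: z_def)
    then show ?thesis using False st x by (auto simp: ratio_le_def mult_ac)
  qed
  ultimately show ?thesis by blast
qed

section \<open>From relative differences to powers of ratios on the open orthant\<close>

lemma L2_ratio_bound:
  fixes s :: real
  assumes "1 \<le> s" "\<And>i. i < m \<Longrightarrow> 0 < x i" "\<And>i. i < m \<Longrightarrow> 0 < y i"
    "\<And>i. i < m \<Longrightarrow> ratio_le s (x i) (y i)"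
  shows "L2_set (\<lambda>i. x i - y i) {..<m} / L2_set (\<lambda>i. x i + y i) {..<m} \<le> (s - 1) / 2"
proof -
  have "L2_set (\<lambda>i. x i - y i) {..<m} = L2_set (\<lambda>i. \<bar>x i - y i\<bar>) {..<m}"
    by (simp add: L2_set_def)
  also have "\<dots> \<le> L2_set (\<lambda>i. (s - 1) / 2 * (x i + y i)) {..<m}"
  proof (rule L2_set_mono)
    fix i assume "i \<in> {..<m}"
    then have i: "i < m" by simp
    \<comment> \<open>The sharp factor is \<open>(s - 1) / (s + 1)\<close>; since \<open>s\<close>
      is at least 1, it is at most \<open>(s - 1) / 2\<close>.\<close>
    have "b - a \<le> (s - 1) / 2 * (b + a)" if "b \<le> s * a" "0 < a" "0 < b" for a b :: real
    proof (cases "b \<le> a")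
      case True
      then have "b - a \<le> 0" by simp
      also have "0 \<le> (s - 1) / 2 * (b + a)" using that assms(1) by simp
      finally show ?thesis .
    next
      case False
      have "0 \<le> (s - 1) * (b - a)" using assms(1) False by (intro mult_nonneg_nonneg) auto
      then show ?thesis using that by (simp add: field_simps)
    qed
    from this[of "x i" "y i"] this[of "y i" "x i"]
    show "\<bar>x i - y i\<bar> \<le> (s - 1) / 2 * (x i + y i)"
      using assms(2-4)[OF i] unfolding abs_le_iff by (auto simp: ratio_le_def add.commute)
  qed simp
  also have "\<dots> = (s - 1) / 2 * L2_set (\<lambda>i. x i + y i) {..<m}"
    using assms(1) by (subst L2_set_right_distrib) auto
  finally have le: "L2_set (\<lambda>i. x i - y i) {..<m} \<le> (s - 1) / 2 * L2_set (\<lambda>i. x i + y i) {..<m}" .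
  show ?thesis
  proof (cases "L2_set (\<lambda>i. x i + y i) {..<m} = 0")
    case False
    then have "0 < L2_set (\<lambda>i. x i + y i) {..<m}" by (simp add: order_less_le)
    then show ?thesis using le by (simp add: divide_le_eq)
  qed (use assms(1) in simp)
qed

text \<open>The extreme ratio is \<open>(1 + D) / (1 - D)\<close>. The constant 4 works up to
  \<open>D = 1 / 2\<close> because
  \<open>(1 + 4 * D) * (1 - D) - (1 + D) = 2 * D * (1 - 2 * D)\<close>.\<close>

lemma ratio_le_of_relative_difference:
  fixes u v D :: real
  assumes "0 < u" "0 < v" "\<bar>u - v\<bar> / (u + v) \<le> D" "0 \<le> D" "D \<le> 1 / 2"
  shows "ratio_le (1 + 4 * D) u v"
proof -
  have *: "b \<le> (1 + 4 * D) * a" if "b - a \<le> D * (b + a)" "0 < a" for a b :: real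
  proof -
    have "b * (1 - D) \<le> a * (1 + D)" using that by (simp add: algebra_simps)
    also have "\<dots> \<le> a * ((1 + 4 * D) * (1 - D))"
    proof (rule mult_left_mono)
      have "0 \<le> 2 * D * (1 - 2 * D)" using assms by (intro mult_nonneg_nonneg) auto
      then show "1 + D \<le> (1 + 4 * D) * (1 - D)" by (simp add: algebra_simps)
    qed (use that in simp)
    finally have "b * (1 - D) \<le> (1 + 4 * D) * a * (1 - D)" by (simp add: mult_ac)
    then show ?thesis using assms by (subst (asm) mult_le_cancel_right) auto
  qed
  have "\<bar>u - v\<bar> \<le> D * (u + v)" using assms by (simp add: field_simps)
  then show ?thesis using assms by (intro ratio_leI *) (auto simp: add.commute)
qed

text \<open>The inequality is used directly only for \<open>s \<le> 1 + 1 / C\<close>. A larger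
  \<open>s\<close> is written as \<open>t ^ N\<close> with \<open>t\<close> in that range, and
  \<open>x\<close> is joined to \<open>y\<close> by \<open>N\<close> steps of ratio
  \<open>t\<close>, with intermediate points chosen coordinatewise inside the open orthant. Since
  \<open>(t ^ a) ^ N = s ^ a\<close>, the number of steps does not affect the exponent.\<close>

lemma pos_rel_lipschitz_ratio:
  assumes "pos_rel_lipschitz m f"
  obtains a :: nat where "\<And>s x y. \<lbrakk>1 \<le> s; x \<in> pos_vecs m; y \<in> pos_vecs m;
    \<And>i. i < m \<Longrightarrow> ratio_le s (x ! i) (y ! i)\<rbrakk> \<Longrightarrow> ratio_le (s ^ a) (f x) (f y)"
proof -
  have fpos: "f x > 0" if "x \<in> pos_vecs m" for x
    using assms that by (simp add: pos_rel_lipschitz_def)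
  obtain C where C: "C > 0" and lip: "\<And>x y. x \<in> pos_vecs m \<Longrightarrow> y \<in> pos_vecs m \<Longrightarrow>
     \<bar>f x - f y\<bar> / (f x + f y)
          \<le> C * (L2_set (\<lambda>i. x ! i - y ! i) {..<m} / L2_set (\<lambda>i. x ! i + y ! i) {..<m})"
    using assms unfolding pos_rel_lipschitz_def by blast
  \<comment> \<open>With \<open>D = C * (s - 1) / 2\<close> one has
    \<open>4 * D = 2 * C * (s - 1)\<close>; Bernoulli's inequality then gives
    \<open>1 + 4 * D \<le> s ^ a\<close>.\<close>
  obtain a :: nat where a: "2 * C \<le> real a" using real_arch_simple by blast
  have small: "ratio_le (s ^ a) (f x) (f y)"
    if s: "1 \<le> s" "s \<le> 1 + 1 / C" and xy: "x \<in> pos_vecs m" "y \<in> pos_vecs m"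
      and close: "\<And>i. i < m \<Longrightarrow> ratio_le s (x ! i) (y ! i)" for s x y
  proof -
    have xy_pos: "0 < x ! i" "0 < y ! i" if "i < m" for i
      using xy that by (auto simp: pos_vecs_def)
    define D where "D = C * ((s - 1) / 2)"
    have "s - 1 \<le> 1 / C" using s by simp
    then have D: "0 \<le> D" "D \<le> 1 / 2" using s C by (auto simp: D_def field_simps)
    have "L2_set (\<lambda>i. x ! i - y ! i) {..<m} / L2_set (\<lambda>i. x ! i + y ! i) {..<m} \<le> (s - 1) / 2"
      by (rule L2_ratio_bound[OF s(1) xy_pos close])
    then have "\<bar>f x - f y\<bar> / (f x + f y) \<le> D"
      unfolding D_def using C
      by (intro order_trans[OF lip[OF xy]] mult_left_mono) auto
    from ratio_le_of_relative_difference[OF fpos[OF xy(1)] fpos[OF xy(2)] this D]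
    have "ratio_le (1 + 4 * D) (f x) (f y)" .
    moreover have "1 + 4 * D \<le> s ^ a"
    proof -
      have "4 * D = 2 * C * (s - 1)" by (simp add: D_def)
      also have "\<dots> \<le> real a * (s - 1)" using a s by (intro mult_right_mono) auto
      finally have "1 + 4 * D \<le> 1 + real a * (s - 1)" by simp
      also have "\<dots> \<le> (1 + (s - 1)) ^ a" using s by (intro Bernoulli_inequality) auto
      finally show ?thesis by simp
    qed
    ultimately show ?thesis using fpos xy by (meson ratio_le_mono order_less_imp_le)
  qed
  have chain: "ratio_le ((s ^ N) ^ a) (f x) (f y)"
    if s: "1 \<le> s" "s \<le> 1 + 1 / C" and xy: "x \<in> pos_vecs m" "y \<in> pos_vecs m"
      and close: "\<And>i. i < m \<Longrightarrow> ratio_le (s ^ N) (x ! i) (y ! i)" for s x y N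
    using xy close
  proof (induction N arbitrary: x)
    case 0
    then have "x ! i = y ! i" if "i < m" for i using that by (auto simp: ratio_le_def intro: antisym)
    then have "x = y" using 0 by (intro nth_equalityI) (auto simp: pos_vecs_def)
    then show ?case by (simp add: ratio_le_def)
  next
    case (Suc N)
    have "\<exists>z>0. ratio_le s (x ! i) z \<and> ratio_le (s ^ N) z (y ! i)" if "i < m" for i
    proof (rule ratio_le_intermediate)
      show "0 < x ! i" "0 < y ! i" using Suc.prems(1,2) that by (auto simp: pos_vecs_def)
      show "1 \<le> s ^ N" using s by simp
      show "ratio_le (s * s ^ N) (x ! i) (y ! i)" using Suc.prems(3)[OF that] by simp
    qed (rule s)
    then obtain z where z: "\<And>i. i < m \<Longrightarrow> z i > 0 \<and> ratio_le s (x ! i) (z i) \<and> ratio_le (s ^ N) (z i) (y ! i)"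
      by metis
    define zs where "zs = map z [0..<m]"
    have zs: "zs \<in> pos_vecs m" using z by (auto simp: zs_def pos_vecs_def)
    have "ratio_le (s ^ a) (f x) (f zs)"
      using s Suc.prems(1) zs by (rule small) (use z in \<open>auto simp: zs_def\<close>)
    moreover have "ratio_le ((s ^ N) ^ a) (f zs) (f y)"
      by (rule Suc.IH) (use zs Suc.prems(2) z in \<open>auto simp: zs_def\<close>)
    ultimately have "ratio_le (s ^ a * (s ^ N) ^ a) (f x) (f y)"
      by (rule ratio_le_trans) (use s in auto)
    then show ?case by (simp add: power_mult_distrib)
  qed
  show thesis
  proof (rule that)
    fix s x y assume s: "1 \<le> s" and xy: "x \<in> pos_vecs m" "y \<in> pos_vecs m"
      and close: "\<And>i. i < m \<Longrightarrow> ratio_le s (x ! i) (y ! i)"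
    obtain N where N: "s < (1 + 1 / C) ^ N" using real_arch_pow[of "1 + 1 / C" s] C by auto
    have "N \<noteq> 0" using N s by (intro notI) simp
    define t where "t = root N s"
    have t: "t ^ N = s" "1 \<le> t" using \<open>N \<noteq> 0\<close> s by (auto simp: t_def)
    have "t \<le> 1 + 1 / C"
    proof (rule ccontr)
      assume "\<not> ?thesis"
      then have "(1 + 1 / C) ^ N \<le> t ^ N" using C by (intro power_mono) auto
      then show False using N t by simp
    qed
    then show "ratio_le (s ^ a) (f x) (f y)"
      using chain[of t x y N] t xy close by simp
  qed
qed

section \<open>Passage to the faces of the orthant\<close>

lemma specialisation_compress:
  fixes xs :: "real list"
  assumes "length xs = m" and I: "I = {i. i < m \<and> xs ! i \<noteq> 0}"
  \<comment> \<open>\<open>e k\<close> is the element of \<open>I\<close> at position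
    \<open>k\<close>, counted from 0: the inverse of the numbering inside
    \<open>specialisation\<close>.\<close>
  defines "e \<equiv> the_inv_into I (\<lambda>j. card {i\<in>I. i < j})"
  shows "f xs = specialisation m f I (map (\<lambda>k. xs ! e k) [0..<card I])"
    and "k < card I \<Longrightarrow> e k \<in> I"
proof -
  let ?h = "\<lambda>j. card {i\<in>I. i < j}"
  have fin: "finite I" using I by simp
  have mono: "?h i < ?h j" if "i \<in> I" "i < j" for i j
    using fin that by (intro psubset_card_mono) auto
  have inj: "inj_on ?h I"
  proof (rule inj_onI)
    fix i j assume "i \<in> I" "j \<in> I" "?h i = ?h j"
    then show "i = j" using mono[of i j] mono[of j i] by (cases i j rule: linorder_cases) auto
  qed
  have less: "?h j < card I" if "j \<in> I" for j
    using fin that by (intro psubset_card_mono) auto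
  have "?h ` I = {..<card I}"
    using less card_image[OF inj] by (intro card_subset_eq) auto
  then show "k < card I \<Longrightarrow> e k \<in> I"
    unfolding e_def by (intro the_inv_into_into[OF inj]) auto
  have "e (?h j) = j" if "j \<in> I" for j
    unfolding e_def using the_inv_into_f_f[OF inj that] .
  then have "map (\<lambda>j. if j \<in> I then map (\<lambda>k. xs ! e k) [0..<card I] ! ?h j else 0) [0..<m] = xs"
    using less assms(1) by (intro nth_equalityI) (auto simp: I)
  then show "f xs = specialisation m f I (map (\<lambda>k. xs ! e k) [0..<card I])"
    by (simp add: specialisation_def)
qed

text \<open>Comparable vectors have the same zero entries, hence lie on the same open face, where
  the previous bound or identical vanishing applies. There are finitely many faces, and the sum of
  their exponents bounds each of them.\<close>

lemma rel_lipschitz_ratio: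
  assumes "rel_lipschitz m f"
  obtains a :: nat where "\<And>s x y. \<lbrakk>1 \<le> s; x \<in> nonneg_vecs m; y \<in> nonneg_vecs m;
    \<And>i. i < m \<Longrightarrow> ratio_le s (x ! i) (y ! i)\<rbrakk> \<Longrightarrow> ratio_le (s ^ a) (f x) (f y)"
proof -
  let ?Is = "{I. I \<noteq> {} \<and> I \<subseteq> {..<m}}"
  define P where "P I a \<longleftrightarrow> (\<forall>s x y. 1 \<le> s \<longrightarrow> x \<in> pos_vecs (card I) \<longrightarrow> y \<in> pos_vecs (card I) \<longrightarrow>
    (\<forall>i<card I. ratio_le s (x ! i) (y ! i)) \<longrightarrow>
    ratio_le (s ^ a) (specialisation m f I x) (specialisation m f I y))" for I and a :: nat
  have "\<exists>a. P I a" if "I \<in> ?Is" for I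
  proof -
    consider "pos_rel_lipschitz (card I) (specialisation m f I)"
      | "\<forall>y\<in>pos_vecs (card I). specialisation m f I y = 0"
      using assms \<open>I \<in> ?Is\<close> unfolding rel_lipschitz_def by blast
    then show ?thesis
    proof cases
      case 1
      then obtain a where "P I a" unfolding P_def by (rule pos_rel_lipschitz_ratio) blast
      then show ?thesis ..
    next
      case 2
      then show ?thesis by (simp add: P_def ratio_le_def)
    qed
  qed
  then have "\<forall>I\<in>?Is. \<exists>a. P I a" by blast
  from bchoice[OF this] obtain a where a: "\<And>I. I \<in> ?Is \<Longrightarrow> P I (a I)" by blast
  have "finite ?Is" by (rule finite_subset[of _ "Pow {..<m}"]) auto
  then have a_le: "a I \<le> sum a ?Is" if "I \<in> ?Is" for I
    using that by (intro member_le_sum) auto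
  show thesis
  proof (rule that)
    fix s x y assume s: "1 \<le> s" and xy: "x \<in> nonneg_vecs m" "y \<in> nonneg_vecs m"
      and close: "\<And>i. i < m \<Longrightarrow> ratio_le s (x ! i) (y ! i)"
    have nonneg: "0 \<le> x ! i" "0 \<le> y ! i" if "i < m" for i
      using xy that by (auto simp: nonneg_vecs_def)
    have f_nonneg: "0 \<le> f x" "0 \<le> f y" using assms xy by (auto simp: rel_lipschitz_def)
    have len: "length x = m" "length y = m" using xy by (auto simp: nonneg_vecs_def)
    define I where "I = {i. i < m \<and> x ! i \<noteq> 0}"
    have I': "I = {i. i < m \<and> y ! i \<noteq> 0}"
      unfolding I_def using ratio_le_zero_iff[OF close] nonneg by blast
    show "ratio_le (s ^ sum a ?Is) (f x) (f y)"
    \<comment> \<open>The origin belongs to no specialisation; there both vectors are zero, hence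
      equal.\<close>
    proof (cases "I = {}")
      case True
      then have "x = y" using len I' by (intro nth_equalityI) (auto simp: I_def)
      then show ?thesis using s f_nonneg ratio_le_refl[of "s ^ sum a ?Is" "f x"] by simp
    next
      case False
      then have I: "I \<in> ?Is" by (auto simp: I_def)
      define e where "e = the_inv_into I (\<lambda>j. card {i\<in>I. i < j})"
      have e: "e k \<in> I" if "k < card I" for k
        unfolding e_def by (rule specialisation_compress(2)[OF len(1) I_def that])
      have pos: "0 < x ! i" "0 < y ! i" if "i \<in> I" for i
        using nonneg[of i] that unfolding I_def using I' that by (auto simp: order_less_le)
      let ?c = "\<lambda>z::real list. map (\<lambda>k. z ! e k) [0..<card I]"
      have "ratio_le (s ^ a I) (specialisation m f I (?c x)) (specialisation m f I (?c y))"
      proof (rule a[OF I, unfolded P_def, rule_format])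
        show "?c x \<in> pos_vecs (card I)" "?c y \<in> pos_vecs (card I)"
          using e pos by (auto simp: pos_vecs_def)
        fix k assume k: "k < card I"
        then have "e k < m" using e I by blast
        then show "ratio_le s (?c x ! k) (?c y ! k)" using close k by simp
      qed (rule s)
      then have "ratio_le (s ^ a I) (f x) (f y)"
        using specialisation_compress(1)[OF len(1) I_def] specialisation_compress(1)[OF len(2) I']
        by (simp add: e_def)
      then show ?thesis using a_le[OF I] s f_nonneg by (rule ratio_le_power_mono)
    qed
  qed
qed

section \<open>Comparing the values of a term in two graphs\<close>

fun vars :: "agg \<Rightarrow> var set" where
  "vars (Const c) = {}"
| "vars (Edge u v) = {u, v}"
| "vars (Equal u v) = {u, v}"
| "vars (App f ts) = (\<Union>t\<in>set ts. vars t)"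
| "vars (Avg v t) = insert v (vars t)"
| "vars (LAvg w v t) = {w, v} \<union> vars t"
| "vars (MaxV v t) = insert v (vars t)"
| "vars (MinV v t) = insert v (vars t)"
| "vars (SumV v t) = insert v (vars t)"

lemma finite_vars: "finite (vars t)"
  by (induction t) auto

text \<open>The atomic type of \<open>x\<close> over the assigned vertices. It is recorded by sets
  of variables rather than vertices, so that types in different graphs can be equal.\<close>

definition type_over :: "var set \<Rightarrow> 'a graph \<Rightarrow> (var \<Rightarrow> 'a) \<Rightarrow> 'a \<Rightarrow> var set \<times> var set" where
  "type_over W G \<sigma> x = ({u\<in>W. \<sigma> u = x}, {u\<in>W. {\<sigma> u, x} \<in> snd G})"

definition realisations :: "var set \<Rightarrow> 'a graph \<Rightarrow> (var \<Rightarrow> 'a) \<Rightarrow> var set \<times> var set \<Rightarrow> 'a set" where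
  "realisations W G \<sigma> \<kappa> = {x \<in> fst G. type_over W G \<sigma> x = \<kappa>}"

definition same_type :: "var set \<Rightarrow> 'a graph \<Rightarrow> (var \<Rightarrow> 'a) \<Rightarrow> 'a graph \<Rightarrow> (var \<Rightarrow> 'a) \<Rightarrow> bool" where
  "same_type W G \<sigma> H \<sigma>' \<longleftrightarrow> \<sigma> ` W \<subseteq> fst G \<and> \<sigma>' ` W \<subseteq> fst H \<and>
     (\<forall>u\<in>W. \<forall>v\<in>W. (\<sigma> u = \<sigma> v \<longleftrightarrow> \<sigma>' u = \<sigma>' v) \<and>
        ({\<sigma> u, \<sigma> v} \<in> snd G \<longleftrightarrow> {\<sigma>' u, \<sigma>' v} \<in> snd H))"

definition finite_graph :: "'a graph \<Rightarrow> bool" where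
  "finite_graph G \<longleftrightarrow> finite (fst G) \<and> fst G \<noteq> {} \<and> (\<forall>x. {x} \<notin> snd G)"

text \<open>A quantitative back-and-forth condition. It quantifies over all pairs of assignments of
  the same type, so it is available again after each update of the assignments.\<close>

definition similar :: "real \<Rightarrow> var set \<Rightarrow> 'a graph \<Rightarrow> 'a graph \<Rightarrow> bool" where
  "similar r W G H \<longleftrightarrow> (\<forall>\<sigma> \<sigma>' \<kappa>. same_type W G \<sigma> H \<sigma>' \<longrightarrow>
     ratio_le r (real (card (realisations W G \<sigma> \<kappa>))) (real (card (realisations W H \<sigma>' \<kappa>))))"

lemma same_type_update:
  assumes "same_type W G \<sigma> H \<sigma>'" "finite_graph G" "finite_graph H" "x \<in> fst G" "y \<in> fst H"
    "type_over W G \<sigma> x = type_over W H \<sigma>' y"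
  shows "same_type W G (\<sigma>(v := x)) H (\<sigma>'(v := y))"
proof -
  have eq: "\<sigma> u = x \<longleftrightarrow> \<sigma>' u = y" and edge: "{\<sigma> u, x} \<in> snd G \<longleftrightarrow> {\<sigma>' u, y} \<in> snd H"
    if "u \<in> W" for u
    using assms(6) that unfolding type_over_def by auto
  \<comment> \<open>The types record pairs of an old vertex with the new one; the pair of the
    updated variable with itself is settled by the absence of loops.\<close>
  have "{x, x} \<notin> snd G" "{y, y} \<notin> snd H"
    using assms(2,3) by (auto simp: finite_graph_def)
  then show ?thesis
    using assms(1,4,5) eq edge unfolding same_type_def
    by (auto simp: eq_commute[of x] eq_commute[of y] insert_commute[of x] insert_commute[of y])
qed

section \<open>Sums, maxima and minima over vertices grouped by type\<close>

lemma sum_le_sum_fibres: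
  fixes f :: "'a \<Rightarrow> real" and g :: "'b \<Rightarrow> real"
  assumes "finite X" "finite Y"
    and card: "\<And>\<kappa>. real (card {x\<in>X. k x = \<kappa>}) \<le> s * real (card {y\<in>Y. l y = \<kappa>})"
    and le: "\<And>x y. x \<in> X \<Longrightarrow> y \<in> Y \<Longrightarrow> k x = l y \<Longrightarrow> f x \<le> r * g y"
    and "0 \<le> r" "\<And>y. y \<in> Y \<Longrightarrow> 0 \<le> g y"
  shows "sum f X \<le> r * s * sum g Y"
proof -
  let ?K = "k ` X \<union> l ` Y"
  have "sum f X = (\<Sum>\<kappa>\<in>?K. sum f {x\<in>X. k x = \<kappa>})"
    using assms by (intro sum.group[symmetric]) auto
  also have "\<dots> \<le> (\<Sum>\<kappa>\<in>?K. r * s * sum g {y\<in>Y. l y = \<kappa>})"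
  proof (rule sum_mono)
    fix \<kappa>
    let ?X = "{x\<in>X. k x = \<kappa>}" and ?Y = "{y\<in>Y. l y = \<kappa>}"
    show "sum f ?X \<le> r * s * sum g ?Y"
    proof (cases "?Y = {}")
      case True
      have "card ?X = 0" using card[of \<kappa>] unfolding True by simp
      then have empty: "?X = {}" using assms by (subst (asm) card_0_eq) auto
      show ?thesis unfolding True empty by simp
    next
      case False
      then have pos: "0 < real (card ?Y)" using assms by (simp add: card_gt_0_iff)
      \<comment> \<open>Inside a fibre every \<open>x\<close> is compared with every
        \<open>y\<close>, and the inequalities are summed over all pairs. Thus only the sizes of the
        two fibres enter, and no matching between them is required.\<close>
      have "real (card ?Y) * f x \<le> r * sum g ?Y" if "x \<in> ?X" for x
        using sum_mono[of ?Y "\<lambda>_. f x" "\<lambda>y. r * g y"] le that by (simp add: sum_distrib_left)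
      then have "real (card ?Y) * sum f ?X \<le> real (card ?X) * (r * sum g ?Y)"
        using sum_mono[of ?X "\<lambda>x. real (card ?Y) * f x" "\<lambda>_. r * sum g ?Y"]
        by (simp add: sum_distrib_left)
      also have "\<dots> \<le> s * real (card ?Y) * (r * sum g ?Y)"
        using card assms by (intro mult_right_mono mult_nonneg_nonneg sum_nonneg) auto
      finally have "real (card ?Y) * sum f ?X \<le> real (card ?Y) * (r * s * sum g ?Y)"
        by (simp add: mult_ac)
      then show ?thesis using pos by simp
    qed
  qed
  also have "\<dots> = r * s * (\<Sum>\<kappa>\<in>?K. sum g {y\<in>Y. l y = \<kappa>})"
    by (simp add: sum_distrib_left)
  also have "(\<Sum>\<kappa>\<in>?K. sum g {y\<in>Y. l y = \<kappa>}) = sum g Y"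
    using assms by (intro sum.group) auto
  finally show ?thesis .
qed

lemma ratio_le_sum_fibres:
  assumes "finite X" "finite Y"
    and "\<And>\<kappa>. ratio_le s (real (card {x\<in>X. k x = \<kappa>})) (real (card {y\<in>Y. l y = \<kappa>}))"
    and "\<And>x y. x \<in> X \<Longrightarrow> y \<in> Y \<Longrightarrow> k x = l y \<Longrightarrow> ratio_le r (f x) (g y)"
    and "0 \<le> r" "\<And>x. x \<in> X \<Longrightarrow> 0 \<le> f x" "\<And>y. y \<in> Y \<Longrightarrow> 0 \<le> g y"
  shows "ratio_le (r * s) (sum f X) (sum g Y)"
proof (rule ratio_leI)
  show "sum f X \<le> r * s * sum g Y"
    using assms by (intro sum_le_sum_fibres[of X Y k s l]) (auto simp: ratio_le_def)
  show "sum g Y \<le> r * s * sum f X"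
    using assms by (intro sum_le_sum_fibres[of Y X l s k]) (auto simp: ratio_le_def)
qed

lemma Max_image_le_mult:
  fixes f :: "'a \<Rightarrow> real"
  assumes "finite X" "finite Y" "X \<noteq> {}"
    and "\<And>x. x \<in> X \<Longrightarrow> \<exists>y\<in>Y. f x \<le> r * g y" and "0 \<le> r"
  shows "Max (f ` X) \<le> r * Max (g ` Y)"
proof -
  have "Max (f ` X) \<in> f ` X" using assms by (intro Max_in) auto
  then obtain x where x: "x \<in> X" "Max (f ` X) = f x" by auto
  then obtain y where y: "y \<in> Y" "f x \<le> r * g y" using assms by blast
  note y(2)
  also have "r * g y \<le> r * Max (g ` Y)" using assms y by (intro mult_left_mono Max_ge) auto
  finally show ?thesis using x by simp
qed

lemma Min_image_le_mult:
  fixes f :: "'a \<Rightarrow> real"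
  assumes "finite X" "finite Y" "Y \<noteq> {}"
    and "\<And>y. y \<in> Y \<Longrightarrow> \<exists>x\<in>X. f x \<le> r * g y"
  shows "Min (f ` X) \<le> r * Min (g ` Y)"
proof -
  have "Min (g ` Y) \<in> g ` Y" using assms by (intro Min_in) auto
  then obtain y where y: "y \<in> Y" "Min (g ` Y) = g y" by auto
  then obtain x where x: "x \<in> X" "f x \<le> r * g y" using assms by blast
  have "Min (f ` X) \<le> f x" using assms x by (intro Min_le) auto
  then show ?thesis using x y by simp
qed

lemma interp_nonneg:
  assumes "finite (fst G)" "fst G \<noteq> {}"
  shows "agg_term F_rellip t \<Longrightarrow> 0 \<le> interp G \<sigma> t"
proof (induction t arbitrary: \<sigma>)
  case (App f ts)
  have "map (interp G \<sigma>) ts \<in> nonneg_vecs (length ts)"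
    using App by (auto simp: nonneg_vecs_def)
  then show ?case using App.prems by (auto simp: F_rellip_def rel_lipschitz_def)
next
  case (MaxV v t)
  have "Max ((\<lambda>x. interp G (\<sigma>(v := x)) t) ` fst G) \<in> (\<lambda>x. interp G (\<sigma>(v := x)) t) ` fst G"
    using assms by (intro Max_in) auto
  then show ?case using MaxV by auto
next
  case (MinV v t)
  have "Min ((\<lambda>x. interp G (\<sigma>(v := x)) t) ` fst G) \<in> (\<lambda>x. interp G (\<sigma>(v := x)) t) ` fst G"
    using assms by (intro Min_in) auto
  then show ?case using MinV by auto
qed (auto intro!: sum_nonneg divide_nonneg_nonneg)

text \<open>Comparable counts vanish together, so a type realised in one graph is realised in the
  other. This provides the partner vertex for maxima and minima.\<close>

lemma similar_extension:
  assumes "similar s W G H" "same_type W G \<sigma> H \<sigma>'" "finite (fst G)" "x \<in> fst G"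
  shows "\<exists>y\<in>fst H. type_over W G \<sigma> x = type_over W H \<sigma>' y"
proof -
  let ?\<kappa> = "type_over W G \<sigma> x"
  have "x \<in> realisations W G \<sigma> ?\<kappa>" using assms by (simp add: realisations_def)
  then have "card (realisations W G \<sigma> ?\<kappa>) \<noteq> 0"
    using assms(3) by (subst card_0_eq) (auto simp: realisations_def)
  moreover have "ratio_le s (real (card (realisations W G \<sigma> ?\<kappa>))) (real (card (realisations W H \<sigma>' ?\<kappa>)))"
    using assms unfolding similar_def by blast
  ultimately have "card (realisations W H \<sigma>' ?\<kappa>) \<noteq> 0"
    using ratio_le_zero_iff by fastforce
  then have "realisations W H \<sigma>' ?\<kappa> \<noteq> {}" by auto
  then obtain y where "y \<in> fst H" "type_over W H \<sigma>' y = ?\<kappa>" by (auto simp: realisations_def)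
  then show ?thesis by (intro bexI[of _ y]) simp_all
qed

lemma similar_sym: "similar s W G H \<Longrightarrow> similar s W H G"
  unfolding similar_def same_type_def by (metis ratio_le_sym)

lemma same_type_sym: "same_type W G \<sigma> H \<sigma>' \<Longrightarrow> same_type W H \<sigma>' G \<sigma>"
  unfolding same_type_def by auto

lemma similar_card:
  assumes "similar s W G H" "same_type W G \<sigma> H \<sigma>'"
  shows "ratio_le s (real (card {x \<in> fst G. type_over W G \<sigma> x = \<kappa>}))
    (real (card {x \<in> fst H. type_over W H \<sigma>' x = \<kappa>}))"
  using assms unfolding similar_def realisations_def by blast

text \<open>For \<open>w\<close> in \<open>W\<close> the type of \<open>x\<close> already decides
  whether \<open>x\<close> is adjacent to \<open>\<sigma> w\<close>, so each fibre of the
  neighbourhood is either a full fibre of the vertex set or empty, in both graphs alike.\<close>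

lemma similar_card_neighbours:
  assumes "similar s W G H" "same_type W G \<sigma> H \<sigma>'" "w \<in> W"
  shows "ratio_le s (real (card {x \<in> neighbours G (\<sigma> w). type_over W G \<sigma> x = \<kappa>}))
    (real (card {x \<in> neighbours H (\<sigma>' w). type_over W H \<sigma>' x = \<kappa>}))"
proof -
  have "{x \<in> neighbours K (\<rho> w). type_over W K \<rho> x = \<kappa>} =
      (if w \<in> snd \<kappa> then {x \<in> fst K. type_over W K \<rho> x = \<kappa>} else {})" for K :: "'a graph" and \<rho>
    using \<open>w \<in> W\<close> by (auto simp: neighbours_def type_over_def)
  then show ?thesis using similar_card[OF assms(1,2)] by (simp add: ratio_le_def)
qed

text \<open>
  Since \<open>W\<close> also contains the bound variables of the term, the same \<open>W\<close> serves all subterms, and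
  updating an assignment at a bound variable preserves having the same type over \<open>W\<close>.
\<close>

lemma interp_ratio:
  fixes t :: agg and W :: "var set"
  assumes "agg_term F_rellip t" "vars t \<subseteq> W"
  shows "\<exists>a. \<forall>s (G :: 'a graph) (H :: 'a graph) \<sigma> \<sigma>'. 1 \<le> s \<longrightarrow> finite_graph G \<longrightarrow> finite_graph H \<longrightarrow>
    similar s W G H \<longrightarrow> same_type W G \<sigma> H \<sigma>' \<longrightarrow> ratio_le (s ^ a) (interp G \<sigma> t) (interp H \<sigma>' t)"
  using assms
proof (induction t)
  case (Const c)
  then show ?case by (intro exI[of _ 0]) (auto intro: ratio_le_refl)
next
  case (Edge u v)
  then show ?case by (intro exI[of _ 0]) (auto simp: same_type_def ratio_le_def)
next
  case (Equal u v)
  then show ?case by (intro exI[of _ 0]) (auto simp: same_type_def ratio_le_def)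
next
  case (App f ts)
  define P where "P t a \<longleftrightarrow> (\<forall>s (G :: 'a graph) (H :: 'a graph) \<sigma> \<sigma>'. 1 \<le> s \<longrightarrow> finite_graph G \<longrightarrow>
    finite_graph H \<longrightarrow> similar s W G H \<longrightarrow> same_type W G \<sigma> H \<sigma>' \<longrightarrow>
    ratio_le (s ^ a) (interp G \<sigma> t) (interp H \<sigma>' t))" for t and a :: nat
  have "\<exists>a. P t a" if "t \<in> set ts" for t
    unfolding P_def using App that by (intro App.IH) auto
  then have "\<forall>t\<in>set ts. \<exists>a. P t a" by blast
  from bchoice[OF this] obtain a where a: "\<And>t. t \<in> set ts \<Longrightarrow> P t (a t)" by blast
  define A where "A = sum a (set ts)"
  have a_le: "a t \<le> A" if "t \<in> set ts" for t
    unfolding A_def using that by (intro member_le_sum) auto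
  have f: "rel_lipschitz (length ts) f" using App.prems by (simp add: F_rellip_def)
  then obtain b :: nat where b: "\<And>s x y. \<lbrakk>1 \<le> s; x \<in> nonneg_vecs (length ts); y \<in> nonneg_vecs (length ts);
    \<And>i. i < length ts \<Longrightarrow> ratio_le s (x ! i) (y ! i)\<rbrakk> \<Longrightarrow> ratio_le (s ^ b) (f x) (f y)"
    using rel_lipschitz_ratio by blast
  have "ratio_le (s ^ (A * b)) (interp G \<sigma> (App f ts)) (interp H \<sigma>' (App f ts))"
    if s: "1 \<le> s" and GH: "finite_graph G" "finite_graph H"
      "similar s W G H" "same_type W G \<sigma> H \<sigma>'" for s and G H :: "'a graph" and \<sigma> \<sigma>'
  proof -
    have nonneg: "0 \<le> interp G \<sigma> t" "0 \<le> interp H \<sigma>' t" if "t \<in> set ts" for t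
      using that App.prems GH by (auto simp: finite_graph_def intro!: interp_nonneg)
    have "ratio_le ((s ^ A) ^ b) (f (map (interp G \<sigma>) ts)) (f (map (interp H \<sigma>') ts))"
    proof (rule b)
      show "1 \<le> s ^ A" using s by simp
      show "map (interp G \<sigma>) ts \<in> nonneg_vecs (length ts)" "map (interp H \<sigma>') ts \<in> nonneg_vecs (length ts)"
        using nonneg by (auto simp: nonneg_vecs_def)
      fix i assume i: "i < length ts"
      then have "ratio_le (s ^ a (ts ! i)) (interp G \<sigma> (ts ! i)) (interp H \<sigma>' (ts ! i))"
        using a[OF nth_mem[OF i]] s GH unfolding P_def by blast
      then have "ratio_le (s ^ A) (interp G \<sigma> (ts ! i)) (interp H \<sigma>' (ts ! i))"
        by (rule ratio_le_power_mono) (use i a_le s nonneg in auto)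
      then show "ratio_le (s ^ A) (map (interp G \<sigma>) ts ! i) (map (interp H \<sigma>') ts ! i)"
        using i by simp
    qed
    then show ?thesis by (simp add: power_mult)
  qed
  then show ?case by blast
next
  case (Avg v t)
  then have "agg_term F_rellip t" "vars t \<subseteq> W" by auto
  from Avg.IH[OF this] obtain a where a: "\<And>s G H \<sigma> \<sigma>'. 1 \<le> s \<Longrightarrow> finite_graph (G :: 'a graph) \<Longrightarrow> finite_graph H \<Longrightarrow>
    similar s W G H \<Longrightarrow> same_type W G \<sigma> H \<sigma>' \<Longrightarrow> ratio_le (s ^ a) (interp G \<sigma> t) (interp H \<sigma>' t)" by blast
  have "ratio_le (s ^ (a + 2)) (interp G \<sigma> (Avg v t)) (interp H \<sigma>' (Avg v t))"
    if s: "1 \<le> s" and GH: "finite_graph G" "finite_graph H" and sim: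
      "similar s W G H" "same_type W G \<sigma> H \<sigma>'" for s and G H :: "'a graph" and \<sigma> \<sigma>'
  proof -
    have fin: "finite (fst G)" "finite (fst H)" using GH by (auto simp: finite_graph_def)
    have nonneg: "0 \<le> interp K \<rho> t" if "finite_graph K" for K :: "'a graph" and \<rho>
      using that Avg.prems by (auto simp: finite_graph_def intro!: interp_nonneg)
    have "ratio_le (s ^ a * s) (\<Sum>x\<in>fst G. interp G (\<sigma>(v := x)) t) (\<Sum>x\<in>fst H. interp H (\<sigma>'(v := x)) t)"
      by (rule ratio_le_sum_fibres[OF fin similar_card[OF sim]])
         (use s GH sim nonneg in \<open>auto intro!: a same_type_update\<close>)
    \<comment> \<open>The number of vertices is a sum of ones, so the same fibre estimate compares
      the denominators. Numerator and denominator cost one factor \<open>s\<close> each.\<close>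
    moreover have "ratio_le (1 * s) (\<Sum>x\<in>fst G. 1) (\<Sum>x\<in>fst H. 1)"
      by (rule ratio_le_sum_fibres[OF fin similar_card[OF sim]]) (auto simp: ratio_le_def)
    ultimately have "ratio_le ((s ^ a * s) * (1 * s)) (interp G \<sigma> (Avg v t)) (interp H \<sigma>' (Avg v t))"
      using s GH nonneg by (simp, intro ratio_le_divide sum_nonneg) auto
    then show ?thesis by (simp add: power_add power2_eq_square mult_ac)
  qed
  then show ?case by blast
next
  case (LAvg w v t)
  then have "agg_term F_rellip t" "vars t \<subseteq> W" by auto
  from LAvg.IH[OF this] obtain a where a: "\<And>s G H \<sigma> \<sigma>'. 1 \<le> s \<Longrightarrow> finite_graph (G :: 'a graph) \<Longrightarrow> finite_graph H \<Longrightarrow>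
    similar s W G H \<Longrightarrow> same_type W G \<sigma> H \<sigma>' \<Longrightarrow> ratio_le (s ^ a) (interp G \<sigma> t) (interp H \<sigma>' t)" by blast
  have "ratio_le (s ^ (a + 2)) (interp G \<sigma> (LAvg w v t)) (interp H \<sigma>' (LAvg w v t))"
    if s: "1 \<le> s" and GH: "finite_graph G" "finite_graph H" and sim:
      "similar s W G H" "same_type W G \<sigma> H \<sigma>'" for s and G H :: "'a graph" and \<sigma> \<sigma>'
  proof -
    have fin: "finite (neighbours G (\<sigma> w))" "finite (neighbours H (\<sigma>' w))"
      using GH by (auto simp: finite_graph_def neighbours_def)
    have sub: "neighbours G (\<sigma> w) \<subseteq> fst G" "neighbours H (\<sigma>' w) \<subseteq> fst H"
      by (auto simp: neighbours_def)
    have w: "w \<in> W" using LAvg.prems by simp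
    have nonneg: "0 \<le> interp K \<rho> t" if "finite_graph K" for K :: "'a graph" and \<rho>
      using that LAvg.prems by (auto simp: finite_graph_def intro!: interp_nonneg)
    \<comment> \<open>The empty neighbourhood needs no case distinction: the quotient is then
      \<open>0 / 0 = 0\<close>, the prescribed default.\<close>
    have unfold: "interp K \<rho> (LAvg w v t) = (\<Sum>x\<in>neighbours K (\<rho> w). interp K (\<rho>(v := x)) t) /
        (\<Sum>x\<in>neighbours K (\<rho> w). 1)" for K :: "'a graph" and \<rho>
      by simp
    have "ratio_le (s ^ a * s) (\<Sum>x\<in>neighbours G (\<sigma> w). interp G (\<sigma>(v := x)) t)
      (\<Sum>x\<in>neighbours H (\<sigma>' w). interp H (\<sigma>'(v := x)) t)"
      by (rule ratio_le_sum_fibres[OF fin similar_card_neighbours[OF sim w]])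
         (use s GH sim nonneg sub in \<open>auto intro!: a same_type_update\<close>)
    moreover have "ratio_le (1 * s) (\<Sum>x\<in>neighbours G (\<sigma> w). 1) (\<Sum>x\<in>neighbours H (\<sigma>' w). 1)"
      by (rule ratio_le_sum_fibres[OF fin similar_card_neighbours[OF sim w]]) (auto simp: ratio_le_def)
    ultimately have "ratio_le ((s ^ a * s) * (1 * s)) (interp G \<sigma> (LAvg w v t)) (interp H \<sigma>' (LAvg w v t))"
      unfolding unfold using s GH nonneg by (intro ratio_le_divide sum_nonneg) auto
    then show ?thesis by (simp only: power_add power2_eq_square mult_ac mult_1_left)
  qed
  then show ?case by blast
next
  case (MaxV v t)
  then have "agg_term F_rellip t" "vars t \<subseteq> W" by auto
  from MaxV.IH[OF this] obtain a where a: "\<And>s G H \<sigma> \<sigma>'. 1 \<le> s \<Longrightarrow> finite_graph (G :: 'a graph) \<Longrightarrow> finite_graph H \<Longrightarrow>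
    similar s W G H \<Longrightarrow> same_type W G \<sigma> H \<sigma>' \<Longrightarrow> ratio_le (s ^ a) (interp G \<sigma> t) (interp H \<sigma>' t)" by blast
  have le: "interp G \<sigma> (MaxV v t) \<le> s ^ a * interp H \<sigma>' (MaxV v t)"
    if s: "1 \<le> s" and GH: "finite_graph G" "finite_graph H" and sim:
      "similar s W G H" "same_type W G \<sigma> H \<sigma>'" for s and G H :: "'a graph" and \<sigma> \<sigma>'
    unfolding interp.simps
  proof (rule Max_image_le_mult)
    show "finite (fst G)" "finite (fst H)" "fst G \<noteq> {}" "0 \<le> s ^ a"
      using s GH by (auto simp: finite_graph_def)
    fix x assume x: "x \<in> fst G"
    \<comment> \<open>A vertex of the same type suffices, whatever the number of such vertices, so
      maxima and minima cost no further factor.\<close>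
    obtain y where y: "y \<in> fst H" "type_over W G \<sigma> x = type_over W H \<sigma>' y"
      using similar_extension[OF sim \<open>finite (fst G)\<close> x] by blast
    with a[OF s GH sim(1) same_type_update[OF sim(2) GH x y]]
    show "\<exists>y\<in>fst H. interp G (\<sigma>(v := x)) t \<le> s ^ a * interp H (\<sigma>'(v := y)) t"
      by (auto simp: ratio_le_def)
  qed
  show ?case
    by (rule exI[of _ a]) (auto simp del: interp.simps intro!: ratio_leI le intro: similar_sym same_type_sym)
next
  case (MinV v t)
  then have "agg_term F_rellip t" "vars t \<subseteq> W" by auto
  from MinV.IH[OF this] obtain a where a: "\<And>s G H \<sigma> \<sigma>'. 1 \<le> s \<Longrightarrow> finite_graph (G :: 'a graph) \<Longrightarrow> finite_graph H \<Longrightarrow>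
    similar s W G H \<Longrightarrow> same_type W G \<sigma> H \<sigma>' \<Longrightarrow> ratio_le (s ^ a) (interp G \<sigma> t) (interp H \<sigma>' t)" by blast
  \<comment> \<open>The roles are swapped relative to the maximum: a bound on the minimum over
    \<open>H\<close> starts from an arbitrary vertex of \<open>G\<close> and extends it to
    \<open>H\<close>.\<close>
  have le: "interp H \<sigma>' (MinV v t) \<le> s ^ a * interp G \<sigma> (MinV v t)"
    if s: "1 \<le> s" and GH: "finite_graph G" "finite_graph H" and sim:
      "similar s W G H" "same_type W G \<sigma> H \<sigma>'" for s and G H :: "'a graph" and \<sigma> \<sigma>'
    unfolding interp.simps
  proof (rule Min_image_le_mult)
    show "finite (fst G)" "finite (fst H)" "fst G \<noteq> {}" using s GH by (auto simp: finite_graph_def)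
    fix x assume x: "x \<in> fst G"
    obtain y where y: "y \<in> fst H" "type_over W G \<sigma> x = type_over W H \<sigma>' y"
      using similar_extension[OF sim \<open>finite (fst G)\<close> x] by blast
    with a[OF s GH sim(1) same_type_update[OF sim(2) GH x y]]
    show "\<exists>y\<in>fst H. interp H (\<sigma>'(v := y)) t \<le> s ^ a * interp G (\<sigma>(v := x)) t"
      by (auto simp: ratio_le_def)
  qed
  show ?case
    by (rule exI[of _ a]) (auto simp del: interp.simps intro!: ratio_leI le intro: similar_sym same_type_sym)
next
  case (SumV v t)
  then have "agg_term F_rellip t" "vars t \<subseteq> W" by auto
  from SumV.IH[OF this] obtain a where a: "\<And>s G H \<sigma> \<sigma>'. 1 \<le> s \<Longrightarrow> finite_graph (G :: 'a graph) \<Longrightarrow> finite_graph H \<Longrightarrow>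
    similar s W G H \<Longrightarrow> same_type W G \<sigma> H \<sigma>' \<Longrightarrow> ratio_le (s ^ a) (interp G \<sigma> t) (interp H \<sigma>' t)" by blast
  have "ratio_le (s ^ a * s) (interp G \<sigma> (SumV v t)) (interp H \<sigma>' (SumV v t))"
    if s: "1 \<le> s" and GH: "finite_graph G" "finite_graph H" and sim:
      "similar s W G H" "same_type W G \<sigma> H \<sigma>'" for s and G H :: "'a graph" and \<sigma> \<sigma>'
  proof -
    have fin: "finite (fst G)" "finite (fst H)" using GH by (auto simp: finite_graph_def)
    have nonneg: "0 \<le> interp K \<rho> t" if "finite_graph K" for K :: "'a graph" and \<rho>
      using that SumV.prems by (auto simp: finite_graph_def intro!: interp_nonneg)
    have "ratio_le (s ^ a * s) (\<Sum>x\<in>fst G. interp G (\<sigma>(v := x)) t) (\<Sum>x\<in>fst H. interp H (\<sigma>'(v := x)) t)"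
      by (rule ratio_le_sum_fibres[OF fin similar_card[OF sim]])
         (use s GH sim nonneg in \<open>auto intro!: a same_type_update\<close>)
    then show ?thesis by simp
  qed
  then show ?case by (intro exI[of _ "a + 1"]) (simp add: mult.commute)
qed

section \<open>Polynomial bounds\<close>

text \<open>A nonzero value lies between \<open>1 / L ^ a\<close> and \<open>L ^ a\<close>. In the
  induction on terms \<open>L\<close> is at least the number of vertices, which controls sums, and
  at least 2, so that a power of \<open>L\<close> absorbs any constant.\<close>

definition poly_bounded :: "real \<Rightarrow> nat \<Rightarrow> real \<Rightarrow> bool" where
  "poly_bounded L a x \<longleftrightarrow> 0 \<le> x \<and> (x = 0 \<or> ratio_le (L ^ a) x 1)"

lemma poly_bounded_mono: "poly_bounded L a x \<Longrightarrow> a \<le> b \<Longrightarrow> 1 \<le> L \<Longrightarrow> poly_bounded L b x"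
  unfolding poly_bounded_def by (auto intro: ratio_le_power_mono)

lemma poly_bounded_const:
  assumes "0 \<le> c"
  shows "\<exists>a. \<forall>L\<ge>2. poly_bounded L a c"
proof (cases "c = 0")
  case False
  then have c: "0 < c" using assms by simp
  obtain a where a: "max c (1 / c) < 2 ^ a" using real_arch_pow[of 2 "max c (1 / c)"] by auto
  have "poly_bounded L a c" if "2 \<le> L" for L
  proof -
    have "(2::real) ^ a \<le> L ^ a" using that by (intro power_mono) auto
    then have "c < L ^ a" "1 / c < L ^ a" using a by auto
    then show ?thesis using c by (auto simp: poly_bounded_def ratio_le_def divide_less_eq)
  qed
  then show ?thesis by blast
qed (simp add: poly_bounded_def)

lemma poly_bounded_sum:
  assumes "finite X" "real (card X) \<le> L" "1 \<le> L" "\<And>x. x \<in> X \<Longrightarrow> poly_bounded L a (f x)"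
  shows "poly_bounded L (a + 1) (sum f X)"
proof -
  have nonneg: "0 \<le> f x" if "x \<in> X" for x using assms(4)[OF that] by (simp add: poly_bounded_def)
  show ?thesis
  proof (cases "\<forall>x\<in>X. f x = 0")
    case True
    then show ?thesis by (simp add: poly_bounded_def)
  next
    case False
    then obtain x where x: "x \<in> X" "f x \<noteq> 0" by blast
    have "sum f X \<le> (\<Sum>x\<in>X. L ^ a)"
      using assms by (intro sum_mono) (force simp: poly_bounded_def ratio_le_def)
    also have "\<dots> \<le> L * L ^ a" using assms by (simp add: mult_right_mono)
    finally have upper: "sum f X \<le> L * L ^ a" .
    \<comment> \<open>Nothing cancels in a sum of nonnegative terms: it is at least its nonzero
      summand \<open>f x\<close>, which preserves the lower bound.\<close>
    have "1 \<le> L ^ a * f x" using assms(4)[OF x(1)] x by (simp add: poly_bounded_def ratio_le_def)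
    also have "\<dots> \<le> L ^ a * sum f X"
      using assms x nonneg by (intro mult_left_mono member_le_sum) auto
    also have "\<dots> \<le> L * (L ^ a * sum f X)"
      using assms nonneg mult_right_mono[of 1 L "L ^ a * sum f X"] by (simp add: sum_nonneg)
    finally show ?thesis using upper nonneg by (simp add: poly_bounded_def ratio_le_def sum_nonneg)
  qed
qed

lemma poly_bounded_divide:
  assumes "poly_bounded L a x" "1 \<le> c" "c \<le> L"
  shows "poly_bounded L (a + 1) (x / c)"
proof (cases "x = 0")
  case False
  then have x: "0 < x" "x \<le> L ^ a" "1 \<le> L ^ a * x"
    using assms(1) by (auto simp: poly_bounded_def ratio_le_def)
  have "1 * L ^ a \<le> (L * c) * L ^ a"
    using assms mult_mono[of 1 L 1 c] by (intro mult_right_mono) auto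
  with x(2) have "x \<le> (L * c) * L ^ a" by simp
  moreover have "c * 1 \<le> L * (L ^ a * x)"
    using x(3) assms by (intro mult_mono) auto
  ultimately show ?thesis using x assms
    by (simp add: poly_bounded_def ratio_le_def divide_le_eq le_divide_eq mult_ac)
qed (simp add: poly_bounded_def)

text \<open>The vector is compared with its pattern of zeros and ones, from which it differs by
  factors of at most \<open>L ^ a\<close> in each entry. The values of \<open>f\<close> at the
  finitely many patterns are constants. Here the ratio bound is applied with an unbounded
  factor.\<close>

lemma poly_bounded_rel_lipschitz:
  assumes f: "rel_lipschitz m f"
  obtains c where "\<And>L xs. \<lbrakk>2 \<le> L; length xs = m; \<And>x. x \<in> set xs \<Longrightarrow> poly_bounded L a x\<rbrakk>
    \<Longrightarrow> poly_bounded L c (f xs)"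
proof -
  obtain b :: nat where b: "\<And>s x y. \<lbrakk>1 \<le> s; x \<in> nonneg_vecs m; y \<in> nonneg_vecs m;
    \<And>i. i < m \<Longrightarrow> ratio_le s (x ! i) (y ! i)\<rbrakk> \<Longrightarrow> ratio_le (s ^ b) (f x) (f y)"
    using rel_lipschitz_ratio[OF f] by blast
  define D where "D = {xs :: real list. set xs \<subseteq> {0, 1} \<and> length xs = m}"
  have fin: "finite D" unfolding D_def by (rule finite_lists_length_eq) simp
  have "\<exists>a. \<forall>L\<ge>2. poly_bounded L a (f xs)" if "xs \<in> D" for xs
  proof (rule poly_bounded_const)
    have "xs \<in> nonneg_vecs m" using that by (auto simp: nonneg_vecs_def D_def)
    then show "0 \<le> f xs" using f by (simp add: rel_lipschitz_def)
  qed
  then have "\<forall>xs\<in>D. \<exists>a. \<forall>L\<ge>2. poly_bounded L a (f xs)" by blast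
  from bchoice[OF this] obtain d where d: "\<And>xs L. xs \<in> D \<Longrightarrow> 2 \<le> L \<Longrightarrow> poly_bounded L (d xs) (f xs)"
    by blast
  show thesis
  proof (rule that)
    fix L :: real and xs assume L: "2 \<le> L" and len: "length xs = m"
      and xs: "\<And>x. x \<in> set xs \<Longrightarrow> poly_bounded L a x"
    define ys where "ys = map (\<lambda>x. if x = 0 then 0 else 1 :: real) xs"
    have ys: "ys \<in> D" using len by (auto simp: ys_def D_def)
    have nonneg: "xs \<in> nonneg_vecs m" "ys \<in> nonneg_vecs m"
      using xs len by (auto simp: nonneg_vecs_def poly_bounded_def ys_def)
    have "ratio_le (L ^ a) (xs ! i) (ys ! i)" if "i < m" for i
      using xs[of "xs ! i"] that len by (auto simp: ys_def poly_bounded_def ratio_le_def)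
    then have ratio: "ratio_le ((L ^ a) ^ b) (f xs) (f ys)"
      using L nonneg by (intro b) auto
    have f_nonneg: "0 \<le> f xs" "0 \<le> f ys" using f nonneg by (auto simp: rel_lipschitz_def)
    have "d ys \<le> sum d D" using fin ys by (intro member_le_sum) auto
    then have fys: "poly_bounded L (sum d D) (f ys)"
      using d[OF ys L] L by (auto intro: poly_bounded_mono)
    show "poly_bounded L (a * b + sum d D) (f xs)"
    proof (cases "f ys = 0")
      case True
      then show ?thesis using ratio_le_zero_iff[OF ratio] f_nonneg by (simp add: poly_bounded_def)
    next
      case False
      then have "ratio_le (L ^ sum d D) (f ys) 1" using fys by (simp add: poly_bounded_def)
      then have "ratio_le ((L ^ a) ^ b * L ^ sum d D) (f xs) 1"
        using L by (intro ratio_le_trans[OF ratio]) auto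
      then show ?thesis using f_nonneg by (simp add: poly_bounded_def power_add power_mult)
    qed
  qed
qed

lemma interp_poly_bounded:
  assumes "agg_term F_rellip t"
  shows "\<exists>a. \<forall>L (G :: 'a graph) \<sigma>. 2 \<le> L \<longrightarrow> finite (fst G) \<longrightarrow> fst G \<noteq> {} \<longrightarrow> real (card (fst G)) \<le> L \<longrightarrow>
    poly_bounded L a (interp G \<sigma> t)"
  using assms
proof (induction t)
  case (Const c)
  then have "0 \<le> c" by simp
  from poly_bounded_const[OF this] show ?case by auto
next
  case (Edge u v)
  then show ?case by (intro exI[of _ 0]) (auto simp: poly_bounded_def ratio_le_def)
next
  case (Equal u v)
  then show ?case by (intro exI[of _ 0]) (auto simp: poly_bounded_def ratio_le_def)
next
  case (App f ts)
  define P where "P t a \<longleftrightarrow> (\<forall>L (G :: 'a graph) \<sigma>. 2 \<le> L \<longrightarrow> finite (fst G) \<longrightarrow> fst G \<noteq> {} \<longrightarrow>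
    real (card (fst G)) \<le> L \<longrightarrow> poly_bounded L a (interp G \<sigma> t))" for t and a :: nat
  have "\<exists>a. P t a" if "t \<in> set ts" for t
    unfolding P_def using App that by (intro App.IH) auto
  then have "\<forall>t\<in>set ts. \<exists>a. P t a" by blast
  from bchoice[OF this] obtain a where a: "\<And>t. t \<in> set ts \<Longrightarrow> P t (a t)" by blast
  define A where "A = sum a (set ts)"
  have a_le: "a t \<le> A" if "t \<in> set ts" for t
    unfolding A_def using that by (intro member_le_sum) auto
  have f: "rel_lipschitz (length ts) f" using App.prems by (simp add: F_rellip_def)
  then obtain c where c: "\<And>L xs. \<lbrakk>2 \<le> L; length xs = length ts; \<And>x. x \<in> set xs \<Longrightarrow> poly_bounded L A x\<rbrakk>
    \<Longrightarrow> poly_bounded L c (f xs)"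
    using poly_bounded_rel_lipschitz by blast
  have "poly_bounded L c (interp G \<sigma> (App f ts))"
    if G: "2 \<le> L" "finite (fst G)" "fst G \<noteq> {}" "real (card (fst G)) \<le> L" for L and G :: "'a graph" and \<sigma>
  proof -
    have "poly_bounded L A (interp G \<sigma> t)" if "t \<in> set ts" for t
    proof -
      have "poly_bounded L (a t) (interp G \<sigma> t)" using a[OF that] G unfolding P_def by blast
      then show ?thesis by (rule poly_bounded_mono) (use a_le[OF that] G in auto)
    qed
    then show ?thesis using G by (auto intro!: c)
  qed
  then show ?case by blast
next
  case (Avg v t)
  then have "agg_term F_rellip t" by simp
  from Avg.IH[OF this] obtain a where a: "\<And>L (G :: 'a graph) \<sigma>. 2 \<le> L \<Longrightarrow> finite (fst G) \<Longrightarrow> fst G \<noteq> {} \<Longrightarrow>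
    real (card (fst G)) \<le> L \<Longrightarrow> poly_bounded L a (interp G \<sigma> t)" by blast
  have "poly_bounded L (a + 1 + 1) (interp G \<sigma> (Avg v t))"
    if G: "2 \<le> L" "finite (fst G)" "fst G \<noteq> {}" "real (card (fst G)) \<le> L" for L and G :: "'a graph" and \<sigma>
    unfolding interp.simps
  proof (rule poly_bounded_divide)
    show "poly_bounded L (a + 1) (\<Sum>x\<in>fst G. interp G (\<sigma>(v := x)) t)"
      using G by (intro poly_bounded_sum a) auto
    show "1 \<le> real (card (fst G))" using G by (simp add: Suc_le_eq card_gt_0_iff)
  qed (rule G)
  then show ?case by blast
next
  case (LAvg w v t)
  then have "agg_term F_rellip t" by simp
  from LAvg.IH[OF this] obtain a where a: "\<And>L (G :: 'a graph) \<sigma>. 2 \<le> L \<Longrightarrow> finite (fst G) \<Longrightarrow> fst G \<noteq> {} \<Longrightarrow>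
    real (card (fst G)) \<le> L \<Longrightarrow> poly_bounded L a (interp G \<sigma> t)" by blast
  have "poly_bounded L (a + 1 + 1) (interp G \<sigma> (LAvg w v t))"
    if G: "2 \<le> L" "finite (fst G)" "fst G \<noteq> {}" "real (card (fst G)) \<le> L" for L and G :: "'a graph" and \<sigma>
  proof (cases "neighbours G (\<sigma> w) = {}")
    case False
    let ?N = "neighbours G (\<sigma> w)"
    have N: "?N \<subseteq> fst G" by (auto simp: neighbours_def)
    then have fin: "finite ?N" using G finite_subset by blast
    have card: "real (card ?N) \<le> L" using card_mono[OF G(2) N] G(4) by linarith
    have "poly_bounded L (a + 1 + 1) ((\<Sum>x\<in>?N. interp G (\<sigma>(v := x)) t) / real (card ?N))"
    proof (rule poly_bounded_divide)
      show "poly_bounded L (a + 1) (\<Sum>x\<in>?N. interp G (\<sigma>(v := x)) t)"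
        using G fin card by (intro poly_bounded_sum a) auto
      show "1 \<le> real (card ?N)" using False fin by (simp add: Suc_le_eq card_gt_0_iff)
    qed (rule card)
    then show ?thesis using False by simp
  qed (simp add: poly_bounded_def)
  then show ?case by blast
next
  case (MaxV v t)
  then have "agg_term F_rellip t" by simp
  from MaxV.IH[OF this] obtain a where a: "\<And>L (G :: 'a graph) \<sigma>. 2 \<le> L \<Longrightarrow> finite (fst G) \<Longrightarrow> fst G \<noteq> {} \<Longrightarrow>
    real (card (fst G)) \<le> L \<Longrightarrow> poly_bounded L a (interp G \<sigma> t)" by blast
  have "poly_bounded L a (interp G \<sigma> (MaxV v t))"
    if G: "2 \<le> L" "finite (fst G)" "fst G \<noteq> {}" "real (card (fst G)) \<le> L" for L and G :: "'a graph" and \<sigma>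
  proof -
    have "interp G \<sigma> (MaxV v t) \<in> (\<lambda>x. interp G (\<sigma>(v := x)) t) ` fst G"
      unfolding interp.simps using G by (intro Max_in) auto
    then show ?thesis using a[OF G] by auto
  qed
  then show ?case by blast
next
  case (MinV v t)
  then have "agg_term F_rellip t" by simp
  from MinV.IH[OF this] obtain a where a: "\<And>L (G :: 'a graph) \<sigma>. 2 \<le> L \<Longrightarrow> finite (fst G) \<Longrightarrow> fst G \<noteq> {} \<Longrightarrow>
    real (card (fst G)) \<le> L \<Longrightarrow> poly_bounded L a (interp G \<sigma> t)" by blast
  have "poly_bounded L a (interp G \<sigma> (MinV v t))"
    if G: "2 \<le> L" "finite (fst G)" "fst G \<noteq> {}" "real (card (fst G)) \<le> L" for L and G :: "'a graph" and \<sigma>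
  proof -
    have "interp G \<sigma> (MinV v t) \<in> (\<lambda>x. interp G (\<sigma>(v := x)) t) ` fst G"
      unfolding interp.simps using G by (intro Min_in) auto
    then show ?thesis using a[OF G] by auto
  qed
  then show ?case by blast
next
  case (SumV v t)
  then have "agg_term F_rellip t" by simp
  from SumV.IH[OF this] obtain a where a: "\<And>L (G :: 'a graph) \<sigma>. 2 \<le> L \<Longrightarrow> finite (fst G) \<Longrightarrow> fst G \<noteq> {} \<Longrightarrow>
    real (card (fst G)) \<le> L \<Longrightarrow> poly_bounded L a (interp G \<sigma> t)" by blast
  have "poly_bounded L (a + 1) (interp G \<sigma> (SumV v t))"
    if G: "2 \<le> L" "finite (fst G)" "fst G \<noteq> {}" "real (card (fst G)) \<le> L" for L and G :: "'a graph" and \<sigma>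
    unfolding interp.simps using G by (intro poly_bounded_sum a) auto
  then show ?case by blast
qed

section \<open>Extension counts in the random graph\<close>

text \<open>Vertices of \<open>A\<close> and \<open>B\<close> are excluded, so that distinct
  candidates \<open>x\<close> are joined to \<open>A\<close> and \<open>B\<close> by disjoint sets
  of vertex pairs.\<close>

definition extensions :: "'a graph \<Rightarrow> 'a set \<Rightarrow> 'a set \<Rightarrow> 'a set" where
  "extensions G A B = {x \<in> fst G - (A \<union> B). (\<forall>a\<in>A. {a, x} \<in> snd G) \<and> (\<forall>b\<in>B. {b, x} \<notin> snd G)}"

text \<open>The main term counts all vertices as candidates, not only those outside \<open>A\<close>
  and \<open>B\<close>. It thus depends on the two sets only through their sizes, at the price of a
  bounded correction.\<close>

definition regular_extensions :: "real \<Rightarrow> nat \<Rightarrow> real \<Rightarrow> 'a graph \<Rightarrow> bool" where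
  "regular_extensions p k d G \<longleftrightarrow> (\<forall>A B. A \<union> B \<subseteq> fst G \<longrightarrow> A \<inter> B = {} \<longrightarrow> card A \<le> k \<longrightarrow> card B \<le> k \<longrightarrow>
     \<bar>real (card (extensions G A B)) - p ^ card A * (1 - p) ^ card B * real (card (fst G))\<bar>
       \<le> d * (p ^ card A * (1 - p) ^ card B * real (card (fst G))))"

section \<open>From regular extension counts to similarity of graphs\<close>

lemma card_image_le_same_kernel:
  assumes "finite A" "\<And>u v. u \<in> A \<Longrightarrow> v \<in> A \<Longrightarrow> f u = f v \<Longrightarrow> g u = g v"
  shows "card (g ` A) \<le> card (f ` A)"
proof (rule surj_card_le)
  show "g ` A \<subseteq> (\<lambda>x. g (inv_into A f x)) ` f ` A"
  proof
    fix y assume "y \<in> g ` A"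
    then obtain u where u: "u \<in> A" "y = g u" by blast
    have "inv_into A f (f u) \<in> A" "f (inv_into A f (f u)) = f u"
      using u by (auto intro: inv_into_into f_inv_into_f)
    then have "g (inv_into A f (f u)) = g u" using assms(2) u by blast
    then show "y \<in> (\<lambda>x. g (inv_into A f x)) ` f ` A" using u by force
  qed
qed (use assms in simp)

lemma card_image_same_kernel:
  assumes "finite A" "\<And>u v. u \<in> A \<Longrightarrow> v \<in> A \<Longrightarrow> f u = f v \<longleftrightarrow> g u = g v"
  shows "card (f ` A) = card (g ` A)"
  using assms by (intro antisym card_image_le_same_kernel) auto

text \<open>
  A type over \<open>W\<close> either says that the new vertex equals a vertex of the assignment, and then has at
  most one realisation, or it counts the common extensions of two disjoint vertex sets.
\<close>

lemma realisations_in_assignment: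
  assumes "u \<in> E"
  shows "realisations W G \<sigma> (E, A) =
    (if u \<in> W \<and> \<sigma> u \<in> fst G \<and> type_over W G \<sigma> (\<sigma> u) = (E, A) then {\<sigma> u} else {})"
proof -
  have "x = \<sigma> u \<and> u \<in> W" if "type_over W G \<sigma> x = (E, A)" for x
    using assms that by (auto simp: type_over_def)
  then show ?thesis by (auto simp: realisations_def)
qed

lemma realisations_outside_assignment:
  "realisations W G \<sigma> ({}, A) =
    (if A \<subseteq> W \<and> \<sigma> ` A \<inter> \<sigma> ` (W - A) = {} then extensions G (\<sigma> ` A) (\<sigma> ` (W - A)) else {})"
  by (auto simp: realisations_def type_over_def extensions_def)

text \<open>The density \<open>q\<close> is common to both graphs and cancels; what remains is the
  ratio of sizes and the two relative errors.\<close>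

lemma ratio_le_of_relative_errors:
  fixes x y q M d n m :: real
  assumes "\<bar>x - q * n\<bar> \<le> d * (q * n)" "\<bar>y - q * m\<bar> \<le> d * (q * m)" "ratio_le M n m"
    and "0 \<le> q" "0 \<le> d" "d < 1" "0 \<le> M"
  shows "ratio_le ((1 + d) / (1 - d) * M) x y"
proof -
  have *: "x \<le> (1 + d) / (1 - d) * M * y"
    if "\<bar>x - q * n\<bar> \<le> d * (q * n)" "\<bar>y - q * m\<bar> \<le> d * (q * m)" "n \<le> M * m" for x y n m
  proof -
    have "x \<le> (1 + d) * (q * n)" using that by (simp add: algebra_simps)
    also have "\<dots> \<le> (1 + d) * (q * (M * m))" using that assms by (intro mult_left_mono) auto
    also have "\<dots> = (1 + d) * M * (q * m)" by (simp add: mult_ac)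
    also have "\<dots> \<le> (1 + d) * M * (y / (1 - d))"
      using that assms by (intro mult_left_mono) (auto simp: pos_le_divide_eq algebra_simps)
    finally show ?thesis by (simp add: mult_ac)
  qed
  show ?thesis using assms by (intro ratio_leI *) (auto simp: ratio_le_def)
qed

text \<open>A type naming an assigned vertex has the same number of realisations, 0 or 1, in both
  graphs, and an inconsistent type has none in either. The other types are extension counts, whose
  main terms differ only through the numbers of vertices.\<close>

lemma regular_extensions_similar:
  assumes G: "regular_extensions p k d G" and H: "regular_extensions p k d H"
    and "finite W" "card W \<le> k" and p: "0 \<le> p" "p \<le> 1" and d: "0 \<le> d" "d < 1" and "1 \<le> M"
    and M: "ratio_le M (real (card (fst G))) (real (card (fst H)))"
  shows "similar ((1 + d) / (1 - d) * M) W G H"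
  unfolding similar_def
proof (intro allI impI)
  fix \<sigma> \<sigma>' and \<kappa> :: "var set \<times> var set" assume type: "same_type W G \<sigma> H \<sigma>'"
  let ?r = "(1 + d) / (1 - d) * M"
  obtain E A where \<kappa>: "\<kappa> = (E, A)" by force
  have "1 \<le> (1 + d) / (1 - d)" using d by simp
  then have r: "1 \<le> ?r" using \<open>1 \<le> M\<close> mult_mono[of 1 "(1 + d) / (1 - d)" 1 M] by simp
  show "ratio_le ?r (real (card (realisations W G \<sigma> \<kappa>))) (real (card (realisations W H \<sigma>' \<kappa>)))"
  proof (cases "E = {}")
    case False
    then obtain u where u: "u \<in> E" by blast
    have "type_over W G \<sigma> (\<sigma> u) = type_over W H \<sigma>' (\<sigma>' u)" "\<sigma> u \<in> fst G" "\<sigma>' u \<in> fst H" if "u \<in> W"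
      using type that by (auto simp: type_over_def same_type_def)
    then show ?thesis unfolding \<kappa> realisations_in_assignment[OF u] using r by (auto simp: ratio_le_def)
  next
    case True
    let ?P = "\<lambda>\<rho>. A \<subseteq> W \<and> \<rho> ` A \<inter> \<rho> ` (W - A) = {}"
    have eq: "\<sigma> u = \<sigma> v \<longleftrightarrow> \<sigma>' u = \<sigma>' v" if "u \<in> W" "v \<in> W" for u v
      using type that by (auto simp: same_type_def)
    have disjoint: "\<rho> ` A \<inter> \<rho> ` (W - A) = {} \<longleftrightarrow> (\<forall>u\<in>A. \<forall>v\<in>W - A. \<not> \<rho> u = \<rho> v)"
      for \<rho> :: "var \<Rightarrow> 'c" by blast
    have "(\<forall>u\<in>A. \<forall>v\<in>W - A. \<not> \<sigma> u = \<sigma> v) \<longleftrightarrow> (\<forall>u\<in>A. \<forall>v\<in>W - A. \<not> \<sigma>' u = \<sigma>' v)" if "A \<subseteq> W"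
      using eq that by (intro ball_cong refl) auto
    then have P: "?P \<sigma> \<longleftrightarrow> (A \<subseteq> W \<and> \<sigma>' ` A \<inter> \<sigma>' ` (W - A) = {})"
      unfolding disjoint by blast
    show ?thesis
    proof (cases "?P \<sigma>")
      case False
      then show ?thesis using P unfolding \<kappa> True realisations_outside_assignment by (auto simp: ratio_le_def)
    next
      case T: True
      have fin: "finite A" "finite (W - A)" using T \<open>finite W\<close> finite_subset by auto
      \<comment> \<open>Assignments need not be injective, so the exponents count distinct vertices.
        These numbers agree because both assignments identify the same variables.\<close>
      have card: "card (\<sigma> ` A) = card (\<sigma>' ` A)" "card (\<sigma> ` (W - A)) = card (\<sigma>' ` (W - A))"
        using fin eq T by (auto intro!: card_image_same_kernel)
      have "card (\<sigma> ` A) \<le> k" "card (\<sigma> ` (W - A)) \<le> k"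
        using card_image_le[OF fin(1), of \<sigma>] card_image_le[OF fin(2), of \<sigma>] card_mono[OF \<open>finite W\<close>, of A]
          card_mono[OF \<open>finite W\<close>, of "W - A"] T \<open>card W \<le> k\<close> by auto
      then have *: "card (\<sigma> ` A) \<le> k" "card (\<sigma> ` (W - A)) \<le> k" "card (\<sigma>' ` A) \<le> k" "card (\<sigma>' ` (W - A)) \<le> k"
        by (simp_all add: card)
      have sub: "\<sigma> ` A \<union> \<sigma> ` (W - A) \<subseteq> fst G" "\<sigma>' ` A \<union> \<sigma>' ` (W - A) \<subseteq> fst H"
        using type T unfolding same_type_def by blast+
      have dis: "\<sigma> ` A \<inter> \<sigma> ` (W - A) = {}" "\<sigma>' ` A \<inter> \<sigma>' ` (W - A) = {}"
        using T P by auto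
      have "ratio_le ?r (real (card (extensions G (\<sigma> ` A) (\<sigma> ` (W - A)))))
        (real (card (extensions H (\<sigma>' ` A) (\<sigma>' ` (W - A)))))"
      proof (rule ratio_le_of_relative_errors)
        show "\<bar>real (card (extensions G (\<sigma> ` A) (\<sigma> ` (W - A))))
          - p ^ card (\<sigma> ` A) * (1 - p) ^ card (\<sigma> ` (W - A)) * real (card (fst G))\<bar>
          \<le> d * (p ^ card (\<sigma> ` A) * (1 - p) ^ card (\<sigma> ` (W - A)) * real (card (fst G)))"
          using G sub dis * unfolding regular_extensions_def by blast
        show "\<bar>real (card (extensions H (\<sigma>' ` A) (\<sigma>' ` (W - A))))
          - p ^ card (\<sigma> ` A) * (1 - p) ^ card (\<sigma> ` (W - A)) * real (card (fst H))\<bar>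
          \<le> d * (p ^ card (\<sigma> ` A) * (1 - p) ^ card (\<sigma> ` (W - A)) * real (card (fst H)))"
          using H sub dis * unfolding card regular_extensions_def by blast
      qed (use M p d \<open>1 \<le> M\<close> in auto)
      then show ?thesis using P T unfolding \<kappa> True realisations_outside_assignment by simp
    qed
  qed
qed

section \<open>Probability that the extension counts are not regular\<close>

lemma card_small_subsets:
  "finite {A. A \<subseteq> {1..n} \<and> card A \<le> k} \<and> card {A. A \<subseteq> {1..n} \<and> card A \<le> k} \<le> (n + 1) ^ k"
proof -
  let ?L = "{xs. set xs \<subseteq> {0..n} \<and> length xs = k}"
  have sub: "{A. A \<subseteq> {1..n} \<and> card A \<le> k} \<subseteq> (\<lambda>xs. set xs \<inter> {1..n}) ` ?L"
  proof
    fix A :: "nat set" assume "A \<in> {A. A \<subseteq> {1..n} \<and> card A \<le> k}"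
    then have A: "A \<subseteq> {1..n}" "card A \<le> k" by auto
    then have fin: "finite A" using finite_subset by blast
    \<comment> \<open>Sets of at most \<open>k\<close> elements become lists of length exactly
      \<open>k\<close>; the padding 0 is no vertex and disappears on intersecting with
      \<open>{1..n}\<close>.\<close>
    define xs where "xs = sorted_list_of_set A @ replicate (k - card A) 0"
    have "xs \<in> ?L" "set xs \<inter> {1..n} = A" using A fin by (auto simp: xs_def)
    then show "A \<in> (\<lambda>xs. set xs \<inter> {1..n}) ` ?L" by blast
  qed
  have fin: "finite ?L" by (rule finite_lists_length_eq) simp
  have "card ?L = (n + 1) ^ k" by (subst card_lists_length_eq) auto
  then show ?thesis using surj_card_le[OF fin sub] finite_surj[OF fin sub] by simp
qed

text \<open>For fixed \<open>A\<close> and \<open>B\<close>, whether \<open>x\<close> is an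
  extension depends only on the pairs in the block \<open>K x\<close>. The blocks are disjoint, so
  the count is a sum of \<open>N\<close> independent indicators and Hoeffding's inequality
  applies.\<close>

lemma extension_count_tail:
  fixes p :: real and A B :: "nat set"
  assumes p: "0 < p" "p < 1" and AB: "A \<union> B \<subseteq> {1..n}" "A \<inter> B = {}"
    and ne: "{1..n} - (A \<union> B) \<noteq> {}" and "0 \<le> \<epsilon>"
  defines "N \<equiv> real (card ({1..n} - (A \<union> B)))"
  shows "measure_pmf.prob (random_graph n p)
    {G. \<bar>real (card (extensions G A B)) - p ^ card A * (1 - p) ^ card B * N\<bar> \<ge> \<epsilon>} \<le> 2 * exp (- 2 * \<epsilon>\<^sup>2 / N)"
proof -
  let ?V = "vertex_pairs n"
  define M where "M = Pi_pmf ?V False (\<lambda>_. bernoulli_pmf p)"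
  define I where "I = {1..n} - (A \<union> B)"
  define K where "K x = (\<lambda>a. {a, x}) ` (A \<union> B)" for x :: nat
  define S where "S x = {b :: nat set \<Rightarrow> bool. (\<forall>a\<in>A. b {a, x}) \<and> (\<forall>c\<in>B. \<not> b {c, x})}" for x
  define X where "X x = indicat_real (S x)" for x
  have fin: "finite A" "finite B" "finite I" using AB finite_subset[of _ "{1..n}"] by (auto simp: I_def)
  have finK: "finite (K x)" for x using fin by (simp add: K_def)
  have KV: "K x \<subseteq> ?V" if "x \<in> I" for x
    using that AB by (auto simp: K_def I_def vertex_pairs_def card_insert_if)
  have disj: "disjoint_family_on K I"
    by (auto simp: disjoint_family_on_def K_def I_def doubleton_eq_iff)
  have "prob_space.indep_vars (measure_pmf M) (\<lambda>_. count_space UNIV) (\<lambda>e b. b e) ?V"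
    unfolding M_def by (rule indep_vars_Pi_pmf[OF finite_vertex_pairs])
  from prob_space.indep_vars_restrict[OF measure_pmf.prob_space_axioms this KV disj]
  have "prob_space.indep_vars (measure_pmf M) (\<lambda>x. PiM (K x) (\<lambda>_. count_space UNIV)) (\<lambda>x b. restrict b (K x)) I"
    by simp
  \<comment> \<open>Each indicator is written as a function of the restriction to its own block, so
    that independence passes from the blocks to the indicators.\<close>
  then have "prob_space.indep_vars (measure_pmf M) (\<lambda>_. borel)
    (\<lambda>x b. (\<lambda>\<omega>. of_bool ((\<forall>a\<in>A. \<omega> {a, x}) \<and> (\<forall>c\<in>B. \<not> \<omega> {c, x})) :: real) (restrict b (K x))) I"
  proof (rule prob_space.indep_vars_compose2[OF measure_pmf.prob_space_axioms])
    fix x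
    have [measurable]: "(\<lambda>\<omega>. \<omega> {a, x}) \<in> measurable (PiM (K x) (\<lambda>_. count_space UNIV)) (count_space (UNIV :: bool set))"
      if "a \<in> A \<union> B" for a
      using that by (intro measurable_component_singleton) (auto simp: K_def)
    show "(\<lambda>\<omega>. of_bool ((\<forall>a\<in>A. \<omega> {a, x}) \<and> (\<forall>c\<in>B. \<not> \<omega> {c, x})) :: real)
      \<in> borel_measurable (PiM (K x) (\<lambda>_. count_space UNIV))"
      using fin unfolding of_bool_def by measurable
  qed
  then have indep: "prob_space.indep_vars (measure_pmf M) (\<lambda>_. borel) X I"
    by (rule prob_space.indep_vars_cong[OF measure_pmf.prob_space_axioms, THEN iffD1, rotated -1])
       (auto simp: X_def S_def K_def fun_eq_iff indicator_def)
  have prob: "measure_pmf.prob M (S x) = p ^ card A * (1 - p) ^ card B" if x: "x \<in> I" for x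
  proof -
    let ?A = "(\<lambda>a. {a, x}) ` A" and ?B = "(\<lambda>a. {a, x}) ` B"
    have inj: "inj_on (\<lambda>a. {a, x}) Y" for Y by (auto simp: inj_on_def doubleton_eq_iff)
    have sub: "?A \<union> ?B \<subseteq> ?V" using KV[OF x] by (auto simp: K_def)
    have dis: "?A \<inter> ?B = {}" using AB by (auto simp: doubleton_eq_iff)
    \<comment> \<open>The event \<open>S x\<close> is a box: \<open>F\<close> prescribes one
      coordinate set per vertex pair, the probability is a product, and unconstrained pairs
      contribute 1.\<close>
    define F where "F e = (if e \<in> ?A then {True} else if e \<in> ?B then {False} else UNIV)" for e
    have "b \<in> Pi V (\<lambda>e. if e \<in> P then {True} else if e \<in> Q then {False} else UNIV) \<longleftrightarrow>
        (\<forall>e\<in>P. b e) \<and> (\<forall>e\<in>Q. \<not> b e)" if "P \<union> Q \<subseteq> V" "P \<inter> Q = {}"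
      for P Q V :: "nat set set" and b
    proof (intro iffI conjI ballI)
      fix e assume b: "b \<in> Pi V (\<lambda>e. if e \<in> P then {True} else if e \<in> Q then {False} else UNIV)"
      show "b e" if "e \<in> P" using Pi_mem[OF b, of e] that \<open>P \<union> Q \<subseteq> V\<close> by auto
      show "\<not> b e" if "e \<in> Q"
      proof -
        have "e \<in> V" "e \<notin> P" using that \<open>P \<union> Q \<subseteq> V\<close> \<open>P \<inter> Q = {}\<close> by auto
        then show ?thesis using Pi_mem[OF b, of e] that by simp
      qed
    qed (simp add: Pi_iff)
    from this[OF sub dis] have "b \<in> S x \<longleftrightarrow> b \<in> Pi ?V F" for b
      unfolding F_def by (simp add: S_def)
    then have "S x = Pi ?V F" by blast
    then have "measure_pmf.prob M (S x) = (\<Prod>e\<in>?V. measure_pmf.prob (bernoulli_pmf p) (F e))"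
      unfolding M_def by (simp add: measure_Pi_pmf_Pi finite_vertex_pairs)
    also have "\<dots> = (\<Prod>e\<in>?A \<union> ?B. measure_pmf.prob (bernoulli_pmf p) (F e))"
      using sub finite_vertex_pairs by (intro prod.mono_neutral_right) (auto simp: F_def)
    also have "\<dots> = (\<Prod>e\<in>?A. measure_pmf.prob (bernoulli_pmf p) (F e)) * (\<Prod>e\<in>?B. measure_pmf.prob (bernoulli_pmf p) (F e))"
      using fin dis by (intro prod.union_disjoint) auto
    also have "(\<Prod>e\<in>?A. measure_pmf.prob (bernoulli_pmf p) (F e)) = (\<Prod>e\<in>?A. p)"
      using p by (intro prod.cong) (auto simp: F_def measure_pmf_single)
    also have "(\<Prod>e\<in>?B. measure_pmf.prob (bernoulli_pmf p) (F e)) = (\<Prod>e\<in>?B. 1 - p)"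
      using p dis by (intro prod.cong) (auto simp: F_def measure_pmf_single)
    finally show ?thesis by (simp add: card_image[OF inj])
  qed
  have "indep_interval_bounded_random_variables M I X (\<lambda>_. 0) (\<lambda>_. 1)"
    by unfold_locales (use fin indep in \<open>auto simp: X_def indicator_def\<close>)
  then interpret Hoeffding_ineq M I X "\<lambda>_. 0" "\<lambda>_. 1" "\<Sum>i\<in>I. measure_pmf.expectation M (X i)"
    by (simp add: Hoeffding_ineq_def)
  have \<mu>: "(\<Sum>i\<in>I. measure_pmf.expectation M (X i)) = p ^ card A * (1 - p) ^ card B * N"
    by (simp add: X_def prob N_def I_def)
  have count: "real (card (extensions ({1..n}, {e \<in> ?V. b e}) A B)) = (\<Sum>x\<in>I. X x b)" for b
  proof -
    have "{a, x} \<in> ?V" if "x \<in> I" "a \<in> A \<union> B" for a x using KV that by (auto simp: K_def)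
    then have "extensions ({1..n}, {e \<in> ?V. b e}) A B = {x\<in>I. b \<in> S x}"
      by (auto simp: extensions_def I_def S_def)
    moreover have "(\<Sum>x\<in>I. X x b) = (\<Sum>x\<in>I. if b \<in> S x then 1 else 0)"
      by (intro sum.cong) (auto simp: X_def)
    ultimately show ?thesis using fin by (simp add: sum.If_cases Int_def)
  qed
  have "0 < card I" using ne fin by (simp add: card_gt_0_iff I_def)
  then have "measure_pmf.prob M {b. \<bar>(\<Sum>x\<in>I. X x b) - p ^ card A * (1 - p) ^ card B * N\<bar> \<ge> \<epsilon>} \<le> 2 * exp (- 2 * \<epsilon>\<^sup>2 / N)"
    using Hoeffding_ineq_abs_ge[OF \<open>0 \<le> \<epsilon>\<close>] unfolding \<mu> by (simp add: N_def I_def)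
  then show ?thesis
    by (simp add: random_graph_def M_def[symmetric] vimage_def count del: One_nat_def)
qed

text \<open>A union bound over the at most \<open>(n + 1) ^ (2 * k)\<close> pairs
  \<open>(A, B)\<close>. Half of the permitted error \<open>d\<close> is left to random fluctuation,
  the other half pays for counting the vertices of \<open>A\<close> and \<open>B\<close> in the main
  term.\<close>

lemma regular_extensions_failure:
  fixes p d :: real
  assumes p: "0 < p" "p < 1" and d: "0 < d"
  obtains c n0 where "0 < c" "\<And>n. n \<ge> n0 \<Longrightarrow> measure_pmf.prob (random_graph n p) {G. \<not> regular_extensions p k d G}
    \<le> 2 * (real n + 1) ^ (2 * k) * exp (- c * real n)"
proof -
  \<comment> \<open>\<open>q\<close> bounds all densities
    \<open>p ^ card A * (1 - p) ^ card B\<close> from below, which gives one threshold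
    \<open>d * q * n / 2\<close> for all pairs. Hoeffding's exponent at that threshold, with at most
    \<open>n\<close> candidates, is at least \<open>c * n\<close>.\<close>
  define q where "q = (p * (1 - p)) ^ k"
  define c where "c = d\<^sup>2 * q\<^sup>2 / 2"
  \<comment> \<open>The first term makes the correction \<open>2 * k\<close> at most
    \<open>d * n / 2\<close>; the others make \<open>n\<close> exceed \<open>2 * k\<close>, so that
    candidates remain.\<close>
  obtain n0 :: nat where n0: "4 * real k / d + 2 * real k + 1 \<le> real n0" using real_arch_simple by blast
  have q: "0 < q" using p by (simp add: q_def)
  show thesis
  proof (rule that)
    show "0 < c" using q d by (simp add: c_def)
    fix n assume "n \<ge> n0"
    then have n: "4 * real k / d + 2 * real k + 1 \<le> real n" using n0 by linarith
    have "0 \<le> 4 * real k / d" using d by simp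
    with n have n2k: "2 * k < n" and n1: "real n > 0" by linarith+
    have n4k: "4 * real k \<le> d * real n"
    proof -
      have "4 * real k / d \<le> real n" using n by linarith
      then show ?thesis using d by (simp add: pos_divide_le_eq mult.commute)
    qed
    let ?S = "{A. A \<subseteq> {1..n} \<and> card A \<le> k}"
    let ?T = "{(A, B). A \<in> ?S \<and> B \<in> ?S \<and> A \<inter> B = {}}"
    define bad where "bad = (\<lambda>(A, B). {G :: nat graph.
      \<bar>real (card (extensions G A B)) - p ^ card A * (1 - p) ^ card B * real (card ({1..n} - (A \<union> B)))\<bar> \<ge> d * q * real n / 2})"
    have fin: "finite ?S" and card: "card ?S \<le> (n + 1) ^ k" using card_small_subsets by auto
    have T: "?T \<subseteq> ?S \<times> ?S" by auto
    then have finT: "finite ?T" by (rule finite_subset) (simp add: fin)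
    have "card ?T \<le> card (?S \<times> ?S)" using T fin by (intro card_mono) auto
    also have "\<dots> \<le> (n + 1) ^ k * (n + 1) ^ k" using card by (simp add: card_cartesian_product mult_mono)
    also have "\<dots> = (n + 1) ^ (2 * k)" by (simp add: mult_2 power_add)
    finally have "real (card ?T) \<le> real ((n + 1) ^ (2 * k))" by (rule of_nat_mono)
    then have cardT: "real (card ?T) \<le> (real n + 1) ^ (2 * k)" by (simp add: add.commute)
    have tail: "measure_pmf.prob (random_graph n p) (bad AB) \<le> 2 * exp (- c * real n)" if "AB \<in> ?T" for AB
    proof -
      obtain A B where AB: "AB = (A, B)" "A \<in> ?S" "B \<in> ?S" "A \<inter> B = {}" using \<open>AB \<in> ?T\<close> by auto
      let ?N = "card ({1..n} - (A \<union> B))"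
      have "card (A \<union> B) \<le> 2 * k" using card_Un_le[of A B] AB by simp
      then have "A \<union> B \<noteq> {1..n}" using n2k by auto
      then have ne: "{1..n} - (A \<union> B) \<noteq> {}" using AB by auto
      then have N: "0 < ?N" by (simp add: card_gt_0_iff)
      have "?N \<le> card {1..n}" by (intro card_mono) auto
      then have Nn: "real ?N \<le> real n" by simp
      have "measure_pmf.prob (random_graph n p) (bad AB) \<le> 2 * exp (- 2 * (d * q * real n / 2)\<^sup>2 / real ?N)"
        unfolding bad_def AB(1) prod.case using AB p d q ne by (intro extension_count_tail) auto
      also have "\<dots> \<le> 2 * exp (- c * real n)"
      proof -
        have "c * real n * real ?N \<le> c * real n * real n"
          using Nn \<open>0 < c\<close> by (intro mult_left_mono) auto
        also have "\<dots> = 2 * (d * q * real n / 2)\<^sup>2"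
          by (simp add: c_def power2_eq_square)
        finally have "c * real n \<le> 2 * (d * q * real n / 2)\<^sup>2 / real ?N"
          using N by (simp add: pos_le_divide_eq)
        then show ?thesis by simp
      qed
      finally show ?thesis .
    qed
    have sub: "{G. fst G = {1..n} \<and> \<not> regular_extensions p k d G} \<subseteq> (\<Union>AB\<in>?T. bad AB)"
    proof
      fix G assume "G \<in> {G. fst G = {1..n} \<and> \<not> regular_extensions p k d G}"
      then have G: "fst G = {1..n}" "\<not> regular_extensions p k d G" by auto
      then obtain A B where AB: "A \<union> B \<subseteq> {1..n}" "A \<inter> B = {}" "card A \<le> k" "card B \<le> k"
        and far: "d * (p ^ card A * (1 - p) ^ card B * real n) < \<bar>real (card (extensions G A B)) - p ^ card A * (1 - p) ^ card B * real n\<bar>"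
        unfolding regular_extensions_def by (auto simp: not_le)
      define r where "r = p ^ card A * (1 - p) ^ card B"
      let ?N = "card ({1..n} - (A \<union> B))"
      have "p ^ k * (1 - p) ^ k \<le> p ^ card A * (1 - p) ^ card B"
        using p AB by (intro mult_mono power_decreasing) auto
      then have r: "q \<le> r" by (simp add: q_def r_def power_mult_distrib)
      have "card (A \<union> B) \<le> 2 * k" using card_Un_le[of A B] AB by simp
      moreover have "?N = n - card (A \<union> B)" using AB finite_subset[OF AB(1)] by (subst card_Diff_subset) auto
      ultimately have N: "real n - 2 * real k \<le> real ?N" "real ?N \<le> real n" by linarith+
      have "\<bar>r * real n - r * real ?N\<bar> = r * (real n - real ?N)"
        using q r N by (simp add: abs_mult flip: right_diff_distrib)
      also have "\<dots> \<le> r * (2 * real k)" using q r N by (intro mult_left_mono) auto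
      also have "\<dots> \<le> r * (d * real n / 2)" using q r n4k by (intro mult_left_mono) auto
      finally have "\<bar>r * real n - r * real ?N\<bar> \<le> d * (r * real n) / 2" by (simp add: mult_ac)
      then have "d * (r * real n) / 2 \<le> \<bar>real (card (extensions G A B)) - r * real ?N\<bar>"
        using far by (fold r_def) linarith
      moreover have "d * (q * real n) \<le> d * (r * real n)" using r d by (intro mult_left_mono mult_right_mono) auto
      ultimately have "G \<in> bad (A, B)" unfolding bad_def prod.case r_def by (simp add: mult_ac)
      then show "G \<in> (\<Union>AB\<in>?T. bad AB)" using AB by auto
    qed
    have "AE G in random_graph n p. fst G = {1..n}"
      by (auto simp: AE_measure_pmf_iff random_graph_def)
    then have "measure_pmf.prob (random_graph n p) {G. \<not> regular_extensions p k d G}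
      = measure_pmf.prob (random_graph n p) {G. fst G = {1..n} \<and> \<not> regular_extensions p k d G}"
      by (intro measure_eq_AE) auto
    also have "\<dots> \<le> measure_pmf.prob (random_graph n p) (\<Union>AB\<in>?T. bad AB)"
      using sub by (intro measure_pmf.finite_measure_mono) auto
    also have "\<dots> \<le> (\<Sum>AB\<in>?T. measure_pmf.prob (random_graph n p) (bad AB))"
      using finT by (intro measure_UNION_le) auto
    also have "\<dots> \<le> (\<Sum>AB\<in>?T. 2 * exp (- c * real n))" by (intro sum_mono tail)
    also have "\<dots> = real (card ?T) * (2 * exp (- c * real n))" by simp
    also have "\<dots> \<le> (real n + 1) ^ (2 * k) * (2 * exp (- c * real n))"
      using cardT by (intro mult_right_mono) auto
    finally show "measure_pmf.prob (random_graph n p) {G. \<not> regular_extensions p k d G}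
      \<le> 2 * (real n + 1) ^ (2 * k) * exp (- c * real n)" by (simp add: mult_ac)
  qed
qed

section \<open>Concentration of the value\<close>

lemma random_graph_support:
  assumes "G \<in> set_pmf (random_graph n p)"
  shows "fst G = {1..n}" and "1 \<le> n \<Longrightarrow> finite_graph G"
  using assms by (auto simp: random_graph_def finite_graph_def vertex_pairs_def)

lemma poly_times_exp_tendsto_0:
  fixes c :: real
  assumes "0 < c"
  shows "(\<lambda>n. (real n + 2) ^ j * exp (- c * real n)) \<longlonglongrightarrow> 0"
proof -
  have "filterlim (\<lambda>n. real n + 2) at_top sequentially"
    by (rule filterlim_at_top_mono[OF filterlim_real_sequentially]) (simp add: always_eventually)
  then have "filterlim (\<lambda>n. c * (real n + 2)) at_top sequentially"
    by (rule filterlim_tendsto_pos_mult_at_top[OF tendsto_const assms])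
  then have "(\<lambda>n. (c * (real n + 2)) ^ j / exp (c * (real n + 2))) \<longlonglongrightarrow> 0"
    by (rule filterlim_compose[OF tendsto_power_div_exp_0])
  then have "(\<lambda>n. exp (2 * c) / c ^ j * ((c * (real n + 2)) ^ j / exp (c * (real n + 2)))) \<longlonglongrightarrow> exp (2 * c) / c ^ j * 0"
    by (intro tendsto_mult tendsto_const)
  moreover have "exp (2 * c) / c ^ j * ((c * (real n + 2)) ^ j / exp (c * (real n + 2)))
      = (real n + 2) ^ j * exp (- c * real n)" for n
  proof -
    have "exp (2 * c) = exp (- c * real n) * exp (c * (real n + 2))"
      by (simp add: algebra_simps flip: exp_add)
    then show ?thesis using assms by (simp add: power_mult_distrib)
  qed
  ultimately show ?thesis by simp
qed

text \<open>Every power is required: off the good event values are only polynomially bounded, with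
  an exponent that grows with \<open>q\<close>.\<close>

lemma regular_extensions_superpolynomial:
  fixes p d :: real
  assumes "0 < p" "p < 1" "0 < d"
  shows "(\<lambda>n. (real n + 2) ^ j * measure_pmf.prob (random_graph n p) {G. \<not> regular_extensions p k d G})
    \<longlonglongrightarrow> 0"
proof -
  obtain c n0 where c: "0 < c" and tail: "\<And>n. n \<ge> n0 \<Longrightarrow>
    measure_pmf.prob (random_graph n p) {G. \<not> regular_extensions p k d G}
      \<le> 2 * (real n + 1) ^ (2 * k) * exp (- c * real n)"
    using regular_extensions_failure[OF assms, of k] by blast
  have "(\<lambda>n. 2 * ((real n + 2) ^ (j + 2 * k) * exp (- c * real n))) \<longlonglongrightarrow> 2 * 0"
    by (intro tendsto_mult tendsto_const poly_times_exp_tendsto_0 c)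
  then have lim: "(\<lambda>n. 2 * ((real n + 2) ^ (j + 2 * k) * exp (- c * real n))) \<longlonglongrightarrow> 0" by simp
  show ?thesis
  proof (rule tendsto_sandwich[OF _ _ tendsto_const lim])
    show "\<forall>\<^sub>F n in sequentially. (real n + 2) ^ j * measure_pmf.prob (random_graph n p) {G. \<not> regular_extensions p k d G}
      \<le> 2 * ((real n + 2) ^ (j + 2 * k) * exp (- c * real n))"
      using eventually_ge_at_top[of n0]
    proof eventually_elim
      fix n assume n: "n0 \<le> n"
      have "(real n + 1) ^ (2 * k) \<le> (real n + 2) ^ (2 * k)" by (intro power_mono) auto
      then have "2 * (real n + 1) ^ (2 * k) * exp (- c * real n) \<le> 2 * (real n + 2) ^ (2 * k) * exp (- c * real n)"
        by (intro mult_right_mono mult_left_mono) auto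
      with tail[OF n] have "measure_pmf.prob (random_graph n p) {G. \<not> regular_extensions p k d G}
          \<le> 2 * (real n + 2) ^ (2 * k) * exp (- c * real n)" by (rule order_trans)
      then have "(real n + 2) ^ j * measure_pmf.prob (random_graph n p) {G. \<not> regular_extensions p k d G}
        \<le> (real n + 2) ^ j * (2 * (real n + 2) ^ (2 * k) * exp (- c * real n))"
        by (intro mult_left_mono) auto
      then show "(real n + 2) ^ j * measure_pmf.prob (random_graph n p) {G. \<not> regular_extensions p k d G}
        \<le> 2 * ((real n + 2) ^ (j + 2 * k) * exp (- c * real n))"
        by (simp add: power_add mult_ac)
    qed
  qed (simp add: always_eventually)
qed

section \<open>From mutual closeness on a likely event to closeness to the mean\<close>

lemma expectation_le_off_event:
  fixes M :: "'a pmf" and f :: "'a \<Rightarrow> real"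
  assumes "finite (set_pmf M)" "\<And>\<omega>. \<omega> \<in> set_pmf M \<Longrightarrow> \<omega> \<in> E \<Longrightarrow> f \<omega> \<le> c"
    "\<And>\<omega>. \<omega> \<in> set_pmf M \<Longrightarrow> f \<omega> \<le> D" "0 \<le> c"
  shows "measure_pmf.expectation M f \<le> c + D * measure_pmf.prob M (- E)"
proof -
  have int: "integrable (measure_pmf M) g" for g :: "'a \<Rightarrow> real"
    by (rule integrable_measure_pmf_finite[OF assms(1)])
  have "measure_pmf.expectation M f \<le> measure_pmf.expectation M (\<lambda>\<omega>. c + D * indicat_real (- E) \<omega>)"
    by (rule integral_mono_AE[OF int int])
       (use assms in \<open>auto simp: AE_measure_pmf_iff indicator_def intro: add_increasing\<close>)
  also have "\<dots> = c + D * measure_pmf.prob M (- E)"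
    by (simp add: Bochner_Integration.integral_add[OF int int])
  finally show ?thesis .
qed

text \<open>On \<open>E\<close> all values are within a factor \<rho> of the reference value
  \<open>v\<close>. The two smallness conditions put the mean within \<open>\<rho>\<^sup>2\<close>
  of \<open>v\<close>: the first bounds the contribution of the complement of \<open>E\<close>, the
  second makes \<open>E\<close> likely enough for the lower bound.\<close>

lemma concentration_step:
  fixes M :: "'a pmf" and X :: "'a \<Rightarrow> real"
  assumes fin: "finite (set_pmf M)" and L: "1 \<le> L"
    and X: "\<And>\<omega>. \<omega> \<in> set_pmf M \<Longrightarrow> poly_bounded L b (X \<omega>)"
    and ratio: "\<And>\<omega> \<omega>'. \<lbrakk>\<omega> \<in> set_pmf M; \<omega>' \<in> set_pmf M; \<omega> \<in> E; \<omega>' \<in> E\<rbrakk> \<Longrightarrow> ratio_le \<rho> (X \<omega>) (X \<omega>')"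
    and \<omega>0: "\<omega>0 \<in> set_pmf M" "\<omega>0 \<in> E" "X \<omega>0 > 0"
    and \<rho>: "1 < \<rho>" "\<rho> \<le> 2"
    and small: "L ^ (2 * b) * measure_pmf.prob M (- E) \<le> \<rho> - 1" "measure_pmf.prob M (- E) \<le> 1 - 1 / \<rho>"
    and q: "0 < q"
  defines "\<mu> \<equiv> measure_pmf.expectation M X"
  shows "0 < \<mu>" and "measure_pmf.expectation M (\<lambda>\<omega>. \<bar>X \<omega> / \<mu> - 1\<bar> powr q)
    \<le> (7 * (\<rho> - 1)) powr q + (8 * L ^ (2 * b)) powr q * measure_pmf.prob M (- E)"
proof -
  let ?\<eta> = "measure_pmf.prob M (- E)"
  define v where "v = X \<omega>0"
  have int: "integrable (measure_pmf M) g" for g :: "'a \<Rightarrow> real"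
    by (rule integrable_measure_pmf_finite[OF fin])
  have X_nonneg: "0 \<le> X \<omega>" and X_le: "X \<omega> \<le> L ^ b" if "\<omega> \<in> set_pmf M" for \<omega>
    using X[OF that] L by (auto simp: poly_bounded_def ratio_le_def)
  have v: "0 < v" "1 \<le> L ^ b * v" using \<omega>0 X[OF \<omega>0(1)] by (auto simp: poly_bounded_def ratio_le_def v_def)
  have L2b: "L ^ (2 * b) = L ^ b * L ^ b" by (simp add: mult_2 power_add)
  have XE: "X \<omega> \<le> \<rho> * v" "v \<le> \<rho> * X \<omega>" if "\<omega> \<in> set_pmf M" "\<omega> \<in> E" for \<omega>
    using ratio[OF that(1) \<omega>0(1) that(2) \<omega>0(2)] by (auto simp: ratio_le_def v_def)
  have "\<mu> \<le> \<rho> * v + L ^ b * ?\<eta>"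
    unfolding \<mu>_def using fin XE X_le v \<rho> by (intro expectation_le_off_event) auto
  \<comment> \<open>Inserting \<open>L ^ b * v\<close>, which is at least 1, turns the additive
    error into a multiple of \<open>v\<close>; hence the exponent \<open>2 * b\<close> in the first
    smallness condition.\<close>
  also have "L ^ b * ?\<eta> \<le> (L ^ b * v) * (L ^ b * ?\<eta>)"
    using v(2) L mult_right_mono[of 1 "L ^ b * v" "L ^ b * ?\<eta>"] by simp
  also have "\<dots> = v * (L ^ (2 * b) * ?\<eta>)" unfolding L2b by (simp only: mult_ac)
  also have "\<dots> \<le> v * (\<rho> - 1)" using small v by (intro mult_left_mono) auto
  finally have "\<mu> \<le> v * (2 * \<rho> - 1)" by (simp add: algebra_simps)
  also have "\<dots> \<le> v * \<rho>\<^sup>2"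
    using v zero_le_power2[of "\<rho> - 1"] by (intro mult_left_mono) (auto simp: power2_diff)
  finally have \<mu>_le: "\<mu> \<le> \<rho>\<^sup>2 * v" by (simp add: mult.commute)
  have "v / \<rho> * (1 / \<rho>) \<le> v / \<rho> * (1 - ?\<eta>)" using small v \<rho> by (intro mult_left_mono) auto
  also have "\<dots> = v / \<rho> * measure_pmf.prob M E"
    using measure_pmf.prob_compl[of E M] by (simp add: Compl_eq_Diff_UNIV)
  also have "\<dots> = measure_pmf.expectation M (\<lambda>\<omega>. v / \<rho> * indicat_real E \<omega>)" by simp
  also have "\<dots> \<le> \<mu>"
    unfolding \<mu>_def by (rule integral_mono_AE[OF int int])
       (use XE X_nonneg \<rho> in \<open>auto simp: AE_measure_pmf_iff indicator_def pos_divide_le_eq mult.commute\<close>)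
  finally have \<mu>_ge: "v \<le> \<rho>\<^sup>2 * \<mu>" using \<rho> by (simp add: field_simps power2_eq_square)
  have "0 < \<rho>\<^sup>2 * \<mu>" using v(1) \<mu>_ge by linarith
  then show \<mu>: "0 < \<mu>" using \<rho> by (simp add: zero_less_mult_iff)
  \<comment> \<open>One factor \<rho> compares \<open>X\<close> with \<open>v\<close>, two more
    compare \<open>v\<close> with the mean. The 7 bounds \<open>\<rho>\<^sup>2 + \<rho> + 1\<close>
    for \<rho> at most 2.\<close>
  have \<rho>3: "1 \<le> \<rho> ^ 3" "\<rho> ^ 3 \<le> 8" "\<rho> ^ 3 - 1 \<le> 7 * (\<rho> - 1)"
  proof -
    show "1 \<le> \<rho> ^ 3" using \<rho> by simp
    show "\<rho> ^ 3 \<le> 8" using power_mono[of \<rho> 2 3] \<rho> by simp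
    have "\<rho>\<^sup>2 \<le> 4" using power_mono[of \<rho> 2 2] \<rho> by simp
    then have "(\<rho> - 1) * (\<rho>\<^sup>2 + \<rho> + 1) \<le> (\<rho> - 1) * 7" using \<rho> by (intro mult_left_mono) auto
    then show "\<rho> ^ 3 - 1 \<le> 7 * (\<rho> - 1)" by (simp add: algebra_simps power2_eq_square power3_eq_cube)
  qed
  have on: "\<bar>X \<omega> / \<mu> - 1\<bar> powr q \<le> (7 * (\<rho> - 1)) powr q" if \<omega>: "\<omega> \<in> set_pmf M" "\<omega> \<in> E" for \<omega>
  proof -
    have "X \<omega> \<le> \<rho> * (\<rho>\<^sup>2 * \<mu>)"
      using XE(1)[OF \<omega>] \<mu>_ge \<rho> by (meson mult_left_mono order_trans less_imp_le zero_less_one)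
    then have up: "X \<omega> / \<mu> \<le> \<rho> ^ 3" using \<mu> by (simp add: pos_divide_le_eq power2_eq_square power3_eq_cube mult_ac)
    have "\<mu> \<le> \<rho>\<^sup>2 * (\<rho> * X \<omega>)"
      using XE(2)[OF \<omega>] \<mu>_le \<rho> by (meson mult_left_mono order_trans zero_le_power2)
    then have "1 \<le> \<rho> ^ 3 * (X \<omega> / \<mu>)" using \<mu> by (simp add: pos_le_divide_eq power2_eq_square power3_eq_cube mult_ac)
    then have "1 - X \<omega> / \<mu> \<le> (\<rho> ^ 3 - 1) * (X \<omega> / \<mu>)" by (simp add: algebra_simps)
    moreover have "(\<rho> ^ 3 - 1) * (X \<omega> / \<mu>) \<le> \<rho> ^ 3 - 1" if "X \<omega> / \<mu> \<le> 1"
      using that \<rho>3(1) mult_left_mono[of "X \<omega> / \<mu>" 1 "\<rho> ^ 3 - 1"] by simp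
    ultimately have "1 - X \<omega> / \<mu> \<le> \<rho> ^ 3 - 1" using \<rho>3(1) by linarith
    with up \<rho>3(3) have "\<bar>X \<omega> / \<mu> - 1\<bar> \<le> 7 * (\<rho> - 1)" by linarith
    then show ?thesis using q by (intro powr_mono2) auto
  qed
  \<comment> \<open>Here \<open>X\<close> is at most \<open>L ^ b\<close> and the mean at least
    \<open>1 / (4 * L ^ b)\<close>; 8 is a generous constant after subtracting 1.\<close>
  have off: "\<bar>X \<omega> / \<mu> - 1\<bar> powr q \<le> (8 * L ^ (2 * b)) powr q" if \<omega>: "\<omega> \<in> set_pmf M" for \<omega>
  proof -
    have "1 \<le> L ^ b * (\<rho>\<^sup>2 * \<mu>)" using v(2) \<mu>_ge L by (meson mult_left_mono order_trans zero_le_power zero_le_one)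
    then have "L ^ b * 1 \<le> L ^ b * (L ^ b * (\<rho>\<^sup>2 * \<mu>))" using L by (intro mult_left_mono) auto
    then have "X \<omega> \<le> L ^ (2 * b) * \<rho>\<^sup>2 * \<mu>" unfolding L2b using X_le[OF \<omega>] by (simp add: mult_ac)
    then have "X \<omega> / \<mu> \<le> L ^ (2 * b) * \<rho>\<^sup>2" using \<mu> by (simp add: pos_divide_le_eq)
    also have "\<dots> \<le> L ^ (2 * b) * 4" using power_mono[of \<rho> 2 2] \<rho> L by (intro mult_left_mono) auto
    finally have "X \<omega> / \<mu> \<le> 4 * L ^ (2 * b)" by simp
    moreover have "0 \<le> X \<omega> / \<mu>" using X_nonneg[OF \<omega>] \<mu> by simp
    moreover have "1 \<le> L ^ (2 * b)" using L by simp
    ultimately have "\<bar>X \<omega> / \<mu> - 1\<bar> \<le> 8 * L ^ (2 * b)" by linarith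
    then show ?thesis using q by (intro powr_mono2) auto
  qed
  show "measure_pmf.expectation M (\<lambda>\<omega>. \<bar>X \<omega> / \<mu> - 1\<bar> powr q)
    \<le> (7 * (\<rho> - 1)) powr q + (8 * L ^ (2 * b)) powr q * ?\<eta>"
    using fin on off by (intro expectation_le_off_event) auto
qed

section \<open>Closed terms in the random graph\<close>

lemma closed_interp_ratio:
  assumes "agg_term F_rellip \<tau>" "closed_term \<tau>" "0 < p" "p < 1"
  obtains a where "\<And>d R n m G H. \<lbrakk>0 \<le> d; d < 1; 1 \<le> R; ratio_le R (real n) (real m); 1 \<le> n; 1 \<le> m;
      G \<in> set_pmf (random_graph n p); H \<in> set_pmf (random_graph m p);
      regular_extensions p (card (vars \<tau>)) d G; regular_extensions p (card (vars \<tau>)) d H\<rbrakk>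
    \<Longrightarrow> ratio_le (((1 + d) / (1 - d) * R) ^ a) (closed_interp \<tau> G) (closed_interp \<tau> H)"
proof -
  obtain a where a: "\<And>s (G :: nat graph) (H :: nat graph) \<sigma> \<sigma>'. 1 \<le> s \<Longrightarrow> finite_graph G \<Longrightarrow> finite_graph H \<Longrightarrow>
    similar s (vars \<tau>) G H \<Longrightarrow> same_type (vars \<tau>) G \<sigma> H \<sigma>' \<Longrightarrow>
    ratio_le (s ^ a) (interp G \<sigma> \<tau>) (interp H \<sigma>' \<tau>)"
    using interp_ratio[OF assms(1) order_refl] by blast
  show thesis
  proof (rule that)
    fix d R :: real and n m :: nat and G H
    assume d: "0 \<le> d" "d < 1" and R: "1 \<le> R" "ratio_le R (real n) (real m)" and nm: "1 \<le> n" "1 \<le> m"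
      and G: "G \<in> set_pmf (random_graph n p)" and H: "H \<in> set_pmf (random_graph m p)"
      and reg: "regular_extensions p (card (vars \<tau>)) d G" "regular_extensions p (card (vars \<tau>)) d H"
    note fst = random_graph_support(1)[OF G] random_graph_support(1)[OF H]
    note fin = random_graph_support(2)[OF G nm(1)] random_graph_support(2)[OF H nm(2)]
    have "1 \<le> (1 + d) / (1 - d)" using d by simp
    then have "1 \<le> (1 + d) / (1 - d) * R" using R mult_mono[of 1 "(1 + d) / (1 - d)" 1 R] by simp
    moreover have "similar ((1 + d) / (1 - d) * R) (vars \<tau>) G H"
      using assms d R reg fst by (intro regular_extensions_similar[of p "card (vars \<tau>)"]) (auto simp: finite_vars)
    \<comment> \<open>A closed term permits any assignment. Sending all variables to vertex 1 gives
      the same type in all loopless graphs: all variables equal, none adjacent.\<close>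
    moreover have "same_type (vars \<tau>) G (\<lambda>_. 1) H (\<lambda>_. 1)"
      using fst fin nm by (auto simp: same_type_def finite_graph_def)
    ultimately show "ratio_le (((1 + d) / (1 - d) * R) ^ a) (closed_interp \<tau> G) (closed_interp \<tau> H)"
      using a fin by (metis closed_interp_eq[OF assms(2)])
  qed
qed

lemma closed_interp_poly_bounded:
  assumes "agg_term F_rellip \<tau>" "closed_term \<tau>"
  obtains b where "\<And>n G. 1 \<le> n \<Longrightarrow> G \<in> set_pmf (random_graph n p) \<Longrightarrow>
    poly_bounded (real n + 2) b (closed_interp \<tau> G)"
proof -
  obtain b where b: "\<And>L (G :: nat graph) \<sigma>. 2 \<le> L \<Longrightarrow> finite (fst G) \<Longrightarrow> fst G \<noteq> {} \<Longrightarrow>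
      real (card (fst G)) \<le> L \<Longrightarrow> poly_bounded L b (interp G \<sigma> \<tau>)"
    using interp_poly_bounded[OF assms(1)] by blast
  show thesis
  proof (rule that)
    fix n G assume "1 \<le> n" "G \<in> set_pmf (random_graph n p)"
    then show "poly_bounded (real n + 2) b (closed_interp \<tau> G)"
      unfolding closed_interp_def using random_graph_support by (intro b) auto
  qed
qed

text \<open>Continuity at \<open>d = 0\<close>. The bound \<open>1 / 2\<close> keeps the event for
  \<open>d\<close> inside the fixed event that decides vanishing.\<close>

lemma close_to_one_ratio:
  fixes \<rho> :: real
  assumes "1 < \<rho>"
  obtains d where "0 < d" "d < 1 / 2" "((1 + d) / (1 - d)) ^ a \<le> \<rho>"
proof -
  have "((\<lambda>d::real. ((1 + d) / (1 - d)) ^ a) \<longlongrightarrow> ((1 + 0) / (1 - 0)) ^ a) (at_right 0)"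
    by (intro tendsto_intros) auto
  then have "\<forall>\<^sub>F d::real in at_right 0. ((1 + d) / (1 - d)) ^ a < \<rho>"
    using assms by (intro order_tendstoD(2)) auto
  moreover have "\<forall>\<^sub>F d::real in at_right 0. d \<in> {0<..<1 / 2}"
    by (rule eventually_at_right_real) simp
  ultimately have "\<forall>\<^sub>F d::real in at_right 0. ((1 + d) / (1 - d)) ^ a < \<rho> \<and> d \<in> {0<..<1 / 2}"
    by (rule eventually_conj)
  then obtain d :: real where "((1 + d) / (1 - d)) ^ a < \<rho>" "d \<in> {0<..<1 / 2}"
    using eventually_happens'[OF trivial_limit_at_right_real] by blast
  then show thesis using that[of d] by auto
qed

lemma regular_extensions_mono:
  assumes "regular_extensions p k d G" "d \<le> e" "0 \<le> p" "p \<le> 1"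
  shows "regular_extensions p k e G"
proof -
  have "d * (p ^ i * (1 - p) ^ j * real n) \<le> e * (p ^ i * (1 - p) ^ j * real n)" for i j n
    using assms by (intro mult_right_mono) auto
  then show ?thesis using assms(1) unfolding regular_extensions_def by (blast intro: order_trans)
qed

text \<open>Replaces a real exponent by a natural one, so that the superpolynomial decay
  applies.\<close>

lemma powr_of_power_bounded:
  fixes q :: real
  obtains j :: nat where "\<And>L. 1 \<le> L \<Longrightarrow> (8 * L ^ m) powr q \<le> 8 powr q * L ^ j"
proof -
  obtain j :: nat where j: "real m * q \<le> real j" using real_arch_simple by blast
  show thesis
  proof (rule that)
    fix L :: real assume L: "1 \<le> L"
    have "(L ^ m) powr q = L powr (real m * q)"
      using L by (simp add: powr_powr flip: powr_realpow)
    also have "\<dots> \<le> L powr real j" using L j by (intro powr_mono) auto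
    finally show "(8 * L ^ m) powr q \<le> 8 powr q * L ^ j"
      using L by (simp add: powr_mult powr_realpow)
  qed
qed

theorem theorem5p2:
  fixes p :: real and \<tau> :: agg and G :: "nat \<Rightarrow> nat graph pmf" and \<mu> :: "nat \<Rightarrow> real"
  assumes "0 < p" and "p < 1"
    and "agg_term F_rellip \<tau>" and "closed_term \<tau>"
  defines "G \<equiv> (\<lambda>n. random_graph n p)"
    and "\<mu> \<equiv> (\<lambda>n. measure_pmf.expectation (G n) (closed_interp \<tau>))"
  shows
    "(whp G (\<lambda>H. closed_interp \<tau> H = 0) \<and>
      (\<forall>q>0. tendsto_Lq q G (\<lambda>n H. closed_interp \<tau> H) 0))
     \<or>
     ((\<forall>\<^sub>F n in sequentially. \<mu> n > 0) \<and>
      whp G (\<lambda>H. closed_interp \<tau> H > 0) \<and>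
      (\<forall>q>0. tendsto_Lq q G (\<lambda>n H. closed_interp \<tau> H / \<mu> n) 1))"
proof -
  let ?X = "closed_interp \<tau> :: nat graph \<Rightarrow> real"
  define E where "E d = {H :: nat graph. regular_extensions p (card (vars \<tau>)) d H}" for d
  obtain a where ratio: "\<And>d R n m H H'. \<lbrakk>0 \<le> d; d < 1; 1 \<le> R; ratio_le R (real n) (real m); 1 \<le> n; 1 \<le> m;
      H \<in> set_pmf (G n); H' \<in> set_pmf (G m); H \<in> E d; H' \<in> E d\<rbrakk>
    \<Longrightarrow> ratio_le (((1 + d) / (1 - d) * R) ^ a) (?X H) (?X H')"
    using closed_interp_ratio[OF assms(3,4,1,2)] unfolding G_def E_def mem_Collect_eq by blast
  obtain b where bounded: "\<And>n H. 1 \<le> n \<Longrightarrow> H \<in> set_pmf (G n) \<Longrightarrow> poly_bounded (real n + 2) b (?X H)"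
    using closed_interp_poly_bounded[OF assms(3,4)] unfolding G_def by blast
  have fin: "finite (set_pmf (G n))" for n
    unfolding G_def by (rule finite_set_random_graph)
  have tail: "(\<lambda>n. (real n + 2) ^ j * measure_pmf.prob (G n) (- E d)) \<longlonglongrightarrow> 0" if "0 < d" for j d
    using regular_extensions_superpolynomial[OF assms(1,2) that] by (simp add: G_def E_def Collect_neg_eq)
  have tail0: "(\<lambda>n. measure_pmf.prob (G n) (- E d)) \<longlonglongrightarrow> 0" if "0 < d" for d
    using tail[OF that, of 0] by simp
  have meets: "\<forall>\<^sub>F n in sequentially. 1 \<le> n \<and> (\<exists>H\<in>set_pmf (G n). H \<in> E d)" if "0 < d" for d
    using order_tendstoD(2)[OF tail0[OF that] zero_less_one] eventually_ge_at_top[of 1]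
  proof eventually_elim
    case (elim n)
    then have "measure_pmf.prob (G n) (- E d) \<noteq> 1" by simp
    then have "\<not> (AE H in G n. H \<in> - E d)" by (subst (asm) measure_pmf.prob_eq_1) auto
    then show ?case using elim by (auto simp: AE_measure_pmf_iff)
  qed
  have whpI: "whp G P" if P: "\<forall>\<^sub>F n in sequentially. \<forall>H\<in>set_pmf (G n). H \<in> E d \<longrightarrow> P H" and d: "0 < d" for P d
    unfolding whp_def
  proof (rule tendsto_sandwich[OF _ _ _ tendsto_const])
    show "(\<lambda>n. 1 - measure_pmf.prob (G n) (- E d)) \<longlonglongrightarrow> 1"
      using tendsto_diff[OF tendsto_const tail0[OF d]] by simp
    show "\<forall>\<^sub>F n in sequentially. 1 - measure_pmf.prob (G n) (- E d) \<le> measure_pmf.prob (G n) {H. P H}"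
      using P
    proof eventually_elim
      case (elim n)
      have "1 - measure_pmf.prob (G n) (- E d) = measure_pmf.prob (G n) (E d)"
        using measure_pmf.prob_compl[of "E d" "G n"] by (simp add: Compl_eq_Diff_UNIV)
      also have "\<dots> \<le> measure_pmf.prob (G n) {H. P H}"
        using elim by (intro measure_pmf.finite_measure_mono_AE) (auto simp: AE_measure_pmf_iff)
      finally show ?case .
    qed
  qed (simp add: always_eventually)
  \<comment> \<open>The ratio of the sizes of \<open>H\<close> and \<open>H'\<close> is unbounded, but any finite factor suffices here.\<close>
  have zero_iff: "?X H = 0 \<longleftrightarrow> ?X H' = 0"
    if "1 \<le> n" "1 \<le> m" "H \<in> set_pmf (G n)" "H' \<in> set_pmf (G m)" "H \<in> E (1/2)" "H' \<in> E (1/2)" for n m H H'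
  proof -
    have ge1: "1 \<le> real k * real l" if "1 \<le> k" "1 \<le> l" for k l :: nat
      using that mult_mono[of 1 "real k" 1 "real l"] by simp
    have "ratio_le (real n * real m) (real n) (real m)"
      using mult_left_mono[OF ge1[OF that(2,2)], of "real n"] mult_left_mono[OF ge1[OF that(1,1)], of "real m"]
      by (intro ratio_leI) (simp_all add: mult_ac)
    moreover have "1 \<le> real n * real m" using that(1,2) by (rule ge1)
    ultimately have "ratio_le (((1 + 1/2) / (1 - 1/2) * (real n * real m)) ^ a) (?X H) (?X H')"
      using that by (intro ratio) auto
    then show ?thesis using ratio_le_zero_iff bounded that by (meson poly_bounded_def)
  qed
  \<comment> \<open>A single graph \<open>H0\<close> decides the alternative: by
    \<open>zero_iff\<close>, all graphs in the events \<open>E (1/2)\<close>, of every size, vanish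
    or are nonzero together with it.\<close>
  obtain n0 where n0: "1 \<le> n0" "\<And>n. n0 \<le> n \<Longrightarrow> \<exists>H\<in>set_pmf (G n). H \<in> E (1/2)"
    using meets[of "1/2"] unfolding eventually_sequentially by auto
  then obtain H0 where H0: "H0 \<in> set_pmf (G n0)" "H0 \<in> E (1/2)" by blast
  show ?thesis
  proof (cases "?X H0 = 0")
    case True
    have zero: "\<forall>\<^sub>F n in sequentially. 1 \<le> n \<and> (\<forall>H\<in>set_pmf (G n). H \<in> E (1/2) \<longrightarrow> ?X H = 0)"
      using eventually_ge_at_top[of n0]
    proof eventually_elim
      case (elim n)
      then have "1 \<le> n" using n0 by simp
      moreover have "?X H = 0" if "H \<in> set_pmf (G n)" "H \<in> E (1/2)" for H
        using zero_iff[OF n0(1) \<open>1 \<le> n\<close> H0(1) that(1) H0(2) that(2)] True by simp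
      ultimately show ?case by blast
    qed
    have "tendsto_Lq q G (\<lambda>n H. ?X H) 0" if q: "0 < q" for q
      unfolding tendsto_Lq_def
    proof -
      obtain j :: nat where j: "\<And>L. 1 \<le> L \<Longrightarrow> (8 * L ^ b) powr q \<le> 8 powr q * L ^ j"
        using powr_of_power_bounded by blast
      have lim: "(\<lambda>n. 8 powr q * ((real n + 2) ^ j * measure_pmf.prob (G n) (- E (1/2)))) \<longlonglongrightarrow> 0"
        using tendsto_mult_right_zero[OF tail[of "1/2" j]] by simp
      show "(\<lambda>n. measure_pmf.expectation (G n) (\<lambda>H. \<bar>?X H - 0\<bar> powr q)) \<longlonglongrightarrow> 0"
      proof (rule tendsto_sandwich[OF _ _ tendsto_const lim])
        show "\<forall>\<^sub>F n in sequentially. measure_pmf.expectation (G n) (\<lambda>H. \<bar>?X H - 0\<bar> powr q)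
          \<le> 8 powr q * ((real n + 2) ^ j * measure_pmf.prob (G n) (- E (1/2)))"
          using zero
        proof eventually_elim
          case (elim n)
          have "measure_pmf.expectation (G n) (\<lambda>H. \<bar>?X H - 0\<bar> powr q)
            \<le> 0 + (8 powr q * (real n + 2) ^ j) * measure_pmf.prob (G n) (- E (1/2))"
          proof (rule expectation_le_off_event[OF fin])
            fix H assume H: "H \<in> set_pmf (G n)"
            then show "\<bar>?X H - 0\<bar> powr q \<le> 0" if "H \<in> E (1/2)" using elim that by simp
            have "poly_bounded (real n + 2) b (?X H)" using bounded elim H by blast
            \<comment> \<open>The factor 8 only brings the bound into the form of
              \<open>powr_of_power_bounded\<close>.\<close>
            then have "0 \<le> ?X H" "?X H \<le> 8 * (real n + 2) ^ b"
              by (auto simp: poly_bounded_def ratio_le_def intro: add_nonneg_nonneg)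
            then have "\<bar>?X H - 0\<bar> powr q \<le> (8 * (real n + 2) ^ b) powr q" using q by (intro powr_mono2) auto
            also have "\<dots> \<le> 8 powr q * (real n + 2) ^ j" by (rule j) simp
            finally show "\<bar>?X H - 0\<bar> powr q \<le> 8 powr q * (real n + 2) ^ j" .
          qed simp
          then show ?case by (simp add: mult_ac)
        qed
      qed (simp add: always_eventually)
    qed
    moreover have "whp G (\<lambda>H. ?X H = 0)"
      by (rule whpI[of "1/2"]) (use zero in \<open>auto elim: eventually_mono\<close>)
    ultimately show ?thesis by blast
  next
    case False
    have pos: "\<forall>\<^sub>F n in sequentially. 1 \<le> n \<and> (\<forall>H\<in>set_pmf (G n). H \<in> E (1/2) \<longrightarrow> 0 < ?X H)"
      using eventually_ge_at_top[of n0]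
    proof eventually_elim
      case (elim n)
      then have "1 \<le> n" using n0 by simp
      moreover have "0 < ?X H" if "H \<in> set_pmf (G n)" "H \<in> E (1/2)" for H
        using zero_iff[OF n0(1) \<open>1 \<le> n\<close> H0(1) that(1) H0(2) that(2)] bounded[OF \<open>1 \<le> n\<close> that(1)] False
        by (auto simp: poly_bounded_def)
      ultimately show ?case by blast
    qed
    \<comment> \<open>Here \<rho> is fixed and \<open>d\<close> chosen from it, both independently
      of \<open>n\<close>; \<rho> is taken close to 1 only when the target accuracy is
      given.\<close>
    have bound: "\<exists>d>0. \<forall>\<^sub>F n in sequentially. 0 < \<mu> n \<and> (\<forall>q>0.
        measure_pmf.expectation (G n) (\<lambda>H. \<bar>?X H / \<mu> n - 1\<bar> powr q)
        \<le> (7 * (\<rho> - 1)) powr q + (8 * (real n + 2) ^ (2 * b)) powr q * measure_pmf.prob (G n) (- E d))"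
      if \<rho>: "1 < \<rho>" "\<rho> \<le> 2" for \<rho>
    proof -
      obtain d where d: "0 < d" "d < 1 / 2" "((1 + d) / (1 - d)) ^ a \<le> \<rho>"
        using close_to_one_ratio[OF \<rho>(1)] by blast
      have E_sub: "E d \<subseteq> E (1/2)"
        using regular_extensions_mono[of p _ d _ "1/2"] d assms(1,2) by (auto simp: E_def)
      have "\<forall>\<^sub>F n in sequentially. (real n + 2) ^ (2 * b) * measure_pmf.prob (G n) (- E d) < \<rho> - 1"
        using \<rho> by (intro order_tendstoD(2)[OF tail[OF d(1)]]) auto
      moreover have "\<forall>\<^sub>F n in sequentially. measure_pmf.prob (G n) (- E d) < 1 - 1 / \<rho>"
        using \<rho> by (intro order_tendstoD(2)[OF tail0[OF d(1)]]) auto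
      ultimately have "\<forall>\<^sub>F n in sequentially. 0 < \<mu> n \<and> (\<forall>q>0.
        measure_pmf.expectation (G n) (\<lambda>H. \<bar>?X H / \<mu> n - 1\<bar> powr q)
        \<le> (7 * (\<rho> - 1)) powr q + (8 * (real n + 2) ^ (2 * b)) powr q * measure_pmf.prob (G n) (- E d))"
        using pos meets[OF d(1)]
      proof eventually_elim
        case (elim n)
        then obtain H1 where H1: "H1 \<in> set_pmf (G n)" "H1 \<in> E d" and n: "1 \<le> n" by blast
        have X1: "0 < ?X H1" using elim H1 E_sub by blast
        have close: "ratio_le \<rho> (?X H) (?X H')"
          if "H \<in> set_pmf (G n)" "H' \<in> set_pmf (G n)" "H \<in> E d" "H' \<in> E d" for H H'
        proof -
          have "ratio_le (((1 + d) / (1 - d) * 1) ^ a) (?X H) (?X H')"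
            using that d n by (intro ratio) (auto simp: ratio_le_def)
          then show ?thesis
            by (rule ratio_le_mono) (use d bounded[OF n] that in \<open>auto simp: poly_bounded_def\<close>)
        qed
        have L: "1 \<le> real n + 2" by simp
        note step = concentration_step[where M = "G n" and X = ?X and L = "real n + 2" and b = b and E = "E d",
            OF fin L _ _ H1 X1 \<rho> less_imp_le[OF elim(1)] less_imp_le[OF elim(2)]]
        show ?case unfolding \<mu>_def
        proof (intro conjI allI impI)
          show "0 < measure_pmf.expectation (G n) ?X" by (rule step(1)[OF _ _ zero_less_one]) (rule bounded[OF n] close; assumption)+
        next
          fix q :: real assume "0 < q"
          show "measure_pmf.expectation (G n) (\<lambda>H. \<bar>?X H / measure_pmf.expectation (G n) ?X - 1\<bar> powr q)
            \<le> (7 * (\<rho> - 1)) powr q + (8 * (real n + 2) ^ (2 * b)) powr q * measure_pmf.prob (G n) (- E d)"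
            by (rule step(2)[OF _ _ \<open>0 < q\<close>]) (rule bounded[OF n] close; assumption)+
        qed
      qed
      then show ?thesis using d(1) by blast
    qed
    have "\<forall>\<^sub>F n in sequentially. 0 < \<mu> n"
      using bound[of 2] by (auto elim: eventually_mono)
    moreover have "whp G (\<lambda>H. 0 < ?X H)"
      by (rule whpI[of "1/2"]) (use pos in \<open>auto elim: eventually_mono\<close>)
    moreover have "tendsto_Lq q G (\<lambda>n H. ?X H / \<mu> n) 1" if q: "0 < q" for q
      unfolding tendsto_Lq_def
    proof (rule tendstoI)
      fix e :: real assume e: "0 < e"
      \<comment> \<open>Chosen so that \<open>(7 * \<delta>) powr q = e / 2\<close>; the minimum
        with 1 then keeps \<rho> at most 2.\<close>
      define \<delta> where "\<delta> = (e / 2) powr (1 / q) / 7"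
      define \<rho> where "\<rho> = 1 + min 1 \<delta>"
      have \<delta>: "0 < \<delta>" using e by (simp add: \<delta>_def)
      then have \<rho>: "1 < \<rho>" "\<rho> \<le> 2" by (auto simp: \<rho>_def)
      have "(7 * (\<rho> - 1)) powr q \<le> (7 * \<delta>) powr q"
        using \<delta> q by (intro powr_mono2) (auto simp: \<rho>_def)
      also have "\<dots> = e / 2" using e q by (simp add: \<delta>_def powr_powr)
      finally have half: "(7 * (\<rho> - 1)) powr q \<le> e / 2" .
      obtain d where d: "0 < d" and bd: "\<forall>\<^sub>F n in sequentially. 0 < \<mu> n \<and> (\<forall>q>0.
        measure_pmf.expectation (G n) (\<lambda>H. \<bar>?X H / \<mu> n - 1\<bar> powr q)
        \<le> (7 * (\<rho> - 1)) powr q + (8 * (real n + 2) ^ (2 * b)) powr q * measure_pmf.prob (G n) (- E d))"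
        using bound[OF \<rho>] by blast
      obtain j :: nat where j: "\<And>L. 1 \<le> L \<Longrightarrow> (8 * L ^ (2 * b)) powr q \<le> 8 powr q * L ^ j"
        using powr_of_power_bounded by blast
      have "(\<lambda>n. 8 powr q * ((real n + 2) ^ j * measure_pmf.prob (G n) (- E d))) \<longlonglongrightarrow> 0"
        using tendsto_mult_right_zero[OF tail[OF d, of j]] by simp
      then have "\<forall>\<^sub>F n in sequentially. 8 powr q * ((real n + 2) ^ j * measure_pmf.prob (G n) (- E d)) < e / 2"
        by (rule order_tendstoD(2)) (use e in simp)
      then show "\<forall>\<^sub>F n in sequentially.
        dist (measure_pmf.expectation (G n) (\<lambda>H. \<bar>?X H / \<mu> n - 1\<bar> powr q)) 0 < e"
        using bd
      proof eventually_elim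
        case (elim n)
        let ?m = "measure_pmf.expectation (G n) (\<lambda>H. \<bar>?X H / \<mu> n - 1\<bar> powr q)"
        have "?m \<le> (7 * (\<rho> - 1)) powr q + (8 * (real n + 2) ^ (2 * b)) powr q * measure_pmf.prob (G n) (- E d)"
          using elim q by blast
        also have "\<dots> \<le> e / 2 + 8 powr q * (real n + 2) ^ j * measure_pmf.prob (G n) (- E d)"
          using half j[of "real n + 2"] by (intro add_mono mult_right_mono) auto
        also have "\<dots> < e" using elim by (simp add: mult_ac)
        finally show ?case by (simp add: integral_nonneg_AE)
      qed
    qed
    ultimately show ?thesis by blast
  qed
qed

end
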